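(* Let $N$ be a positive integer, let $\frac{1}{N+1}<a<1$, and let $F_{N,a}$ be the self-affine function defined in the context. For $x\in(0,1)$ let $(\xi_i)_{i\ge1}$, $M(x)$, $\omega_i$ and $\overline{\omega_i}$ be as defined in the context. A point $x\in(0,1)$ satisfies $F_{N,a}'(x)=\pm\infty$ if and only if $M(x)<\infty$ and the following two limits hold: $$\lim_{n\to\infty}\big((2N+1)a\big)^n\left(1-\sum_{j=1}^\infty a^j\omega_{n+j}\right)=\infty$$ and $$\lim_{n\to\infty}\big((2N+1)a\big)^n\left(1-\sum_{j=1}^\infty a^j\overline{\omega_{n+j}}\right)=\infty.$$ Assuming all these conditions are satisfied, $F_{N,a}'(x)=\infty$ if $M(x)$ is even, and $F_{N,a}'(x)=-\infty$ if $M(x)$ is odd.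
   Context: Construction of $F_{N,a}$. Fix a positive integer $N$ and a real $a$ with $\frac{1}{N+1}<a<1$, and let $b$ be the number with $(N+1)a-Nb=1$ (so $0<b<a$). Let $x_i:=i/(2N+1)$ for $i=0,1,\dots,2N+1$, and for $j=0,1,\dots,N$ put $y_{2j}:=j(a-b)$ and $y_{2j+1}:=(j+1)a-jb$. Set $f_0(x):=x$ on $[0,1]$ and, for $n\ge1$, define $f_n$ recursively on each interval $[x_i,x_{i+1}]$, $i=0,1,\dots,2N$, by $$f_n(x):=y_i+(y_{i+1}-y_i)\,f_{n-1}\big((2N+1)(x-x_i)\big),\qquad x_i\le x\le x_{i+1}.$$ The sequence $(f_n)$ converges uniformly to a continuous function $F_{N,a}:[0,1]\to[0,1]$. Digits. For $x\in[0,1)$ write $x=\sum_{i=1}^\infty \xi_i(2N+1)^{-i}$ with $\xi_i\in\{0,1,\dots,2N\}$, the base $2N+1$ expansion of $x$; when $x$ has two such expansions, take the one ending in all zeros. Let $M(x):=\#\{i\in\mathbb{N}:\xi_i\text{ is odd}\}\in\{0,1,2,\dots\}\cup\{\infty\}$. Put $\omega_i:=\xi_i/2$; when $\xi_i$ is even, $\omega_i\in A:=\{0,1,\dots,N\}$. For $d\in A$ write $\overline d:=N-d$. (When $M(x)<\infty$, $\omega_i\in A$ for all sufficiently large $i$, so both limits in the claim make sense.) $F'(x)=\pm\infty$ means that the two-sided limit of the difference quotient $\frac{F(x+h)-F(x)}{h}$ as $h\to0$ is $+\infty$ or is $-\infty$. *)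

theory Defs
  imports "HOL-Analysis.Analysis" "HOL-Library.Extended_Nat"
begin

section \<open>The self-affine function\<close>

text \<open>The number \<open>b\<close> is the solution of \<open>(N + 1) a - N b = 1\<close>.\<close>

definition slope_b :: "nat \<Rightarrow> real \<Rightarrow> real" where
  "slope_b N a = ((real N + 1) * a - 1) / real N"

definition node_x :: "nat \<Rightarrow> nat \<Rightarrow> real" where
  "node_x N i = real i / real (2 * N + 1)"

definition node_y :: "nat \<Rightarrow> real \<Rightarrow> nat \<Rightarrow> real" where
  "node_y N a i =
    (if even i then real (i div 2) * (a - slope_b N a)
     else (real (i div 2) + 1) * a - real (i div 2) * slope_b N a)"

text \<open>The recursion is meant on the closed intervals \<open>[x\<^sub>i, x\<^bsub>i+1\<^esub>]\<close> for \<open>i \<le> 2 N\<close>, which share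
  their endpoints. The definition takes the right-hand interval at an interior node and the last
  interval at \<open>1\<close>; lemma \<open>approx_Suc\<close> below gives the recursion on every closed interval.
  Values outside \<open>[0, 1]\<close> carry no meaning.\<close>

primrec approx :: "nat \<Rightarrow> real \<Rightarrow> nat \<Rightarrow> real \<Rightarrow> real" where
  "approx N a 0 = (\<lambda>x. x)"
| "approx N a (Suc n) = (\<lambda>x.
     let i = min (2 * N) (nat \<lfloor>real (2 * N + 1) * x\<rfloor>)
     in node_y N a i + (node_y N a (Suc i) - node_y N a i)
          * approx N a n (real (2 * N + 1) * (x - node_x N i)))"

definition F_fun :: "nat \<Rightarrow> real \<Rightarrow> real \<Rightarrow> real" where
  "F_fun N a x = lim (\<lambda>n. approx N a n x)"

lemma slope_b_eq: "0 < N \<Longrightarrow> (real N + 1) * a - real N * slope_b N a = 1"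
  by (simp add: slope_b_def)

lemma slope_b_bounds:
  assumes "0 < N" "1 / (real N + 1) < a" "a < 1"
  shows "0 < slope_b N a" "slope_b N a < a"
  using assms by (simp_all add: slope_b_def field_simps)

lemma node_y_0: "node_y N a 0 = 0"
  by (simp add: node_y_def)

lemma node_y_last: "0 < N \<Longrightarrow> node_y N a (Suc (2 * N)) = 1"
  using slope_b_eq[of N a] by (simp add: node_y_def)

lemma node_y_step:
  "node_y N a (Suc i) - node_y N a i = (if even i then a else - slope_b N a)"
  by (auto simp: node_y_def algebra_simps elim!: evenE oddE)

lemma approx_at_0: "approx N a n 0 = 0"
  by (induction n) (simp_all add: node_y_0 node_x_def)

lemma approx_at_1:
  assumes "0 < N"
  shows "approx N a n 1 = 1"
proof (induction n)
  case (Suc n)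
  have i: "min (2 * N) (nat \<lfloor>real (2 * N + 1) * 1\<rfloor>) = 2 * N"
    by (simp only: mult_1_right floor_of_nat nat_int)
  have z: "real (2 * N + 1) * (1 - node_x N (2 * N)) = 1"
    by (simp add: node_x_def field_simps)
  show ?case
    unfolding approx.simps i Let_def z Suc using node_y_last[OF assms] by simp
qed simp

lemma approx_Suc:
  assumes N: "0 < N" and i: "i \<le> 2 * N" and x: "node_x N i \<le> x" "x \<le> node_x N (Suc i)"
  shows "approx N a (Suc n) x = node_y N a i + (node_y N a (Suc i) - node_y N a i)
           * approx N a n (real (2 * N + 1) * (x - node_x N i))"
proof -
  let ?B = "real (2 * N + 1)"
  have B: "0 < ?B" by simp
  have lo: "real i \<le> ?B * x" and hi: "?B * x \<le> real (Suc i)"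
    using x B by (simp_all add: node_x_def field_simps del: of_nat_Suc)
  show ?thesis
  proof (cases "?B * x = real (Suc i)")
    case False
    then have "\<lfloor>?B * x\<rfloor> = int i"
      using lo hi by (intro floor_unique) auto
    then have "min (2 * N) (nat \<lfloor>?B * x\<rfloor>) = i"
      using i by simp
    then show ?thesis by (simp only: approx.simps Let_def)
  next
    case True
    have z1: "?B * (x - node_x N i) = 1"
      using True B by (simp add: node_x_def right_diff_distrib)
    have fl: "nat \<lfloor>?B * x\<rfloor> = Suc i" unfolding True by (simp only: floor_of_nat nat_int)
    show ?thesis
    proof (cases "i = 2 * N")
      case True
      then have "min (2 * N) (nat \<lfloor>?B * x\<rfloor>) = i" using fl by simp
      then show ?thesis by (simp only: approx.simps Let_def)
    next
      case False
      then have m: "min (2 * N) (nat \<lfloor>?B * x\<rfloor>) = Suc i" using fl i by simp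
      have z0: "?B * (x - node_x N (Suc i)) = 0"
        using True B by (simp add: node_x_def right_diff_distrib del: of_nat_Suc)
      show ?thesis
        unfolding approx.simps(2) Let_def m z0 z1 approx_at_0 approx_at_1[OF N] by simp
    qed
  qed
qed

lemma interval_cover:
  assumes "0 \<le> x" "x \<le> 1"
  obtains i where "i \<le> 2 * N" "node_x N i \<le> x" "x \<le> node_x N (Suc i)"
proof -
  let ?B = "real (2 * N + 1)"
  show ?thesis
  proof (cases "x = 1")
    case True
    show ?thesis by (rule that[of "2 * N"]) (simp_all add: True node_x_def)
  next
    case False
    define i where "i = nat \<lfloor>?B * x\<rfloor>"
    have p: "0 \<le> ?B * x" using assms by simp
    have lo: "real i \<le> ?B * x" and hi: "?B * x < real i + 1"
      unfolding i_def using p by linarith+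
    have "?B * x < ?B" using assms False by simp
    then have "real i < ?B" using lo by linarith
    then have "i \<le> 2 * N" by linarith
    then show ?thesis using lo hi by (intro that[of i]) (auto simp: node_x_def field_simps)
  qed
qed

lemma rescale_bounds:
  assumes "node_x N i \<le> x" "x \<le> node_x N (Suc i)"
  shows "0 \<le> real (2 * N + 1) * (x - node_x N i)" "real (2 * N + 1) * (x - node_x N i) \<le> 1"
proof -
  let ?B = "real (2 * N + 1)"
  have B: "0 < ?B" by simp
  have "?B * (x - node_x N i) = ?B * x - real i"
    using B by (simp add: node_x_def right_diff_distrib)
  moreover have "real i \<le> ?B * x" "?B * x \<le> real i + 1"
    using assms B by (simp_all add: node_x_def field_simps)
  ultimately show "0 \<le> ?B * (x - node_x N i)" "?B * (x - node_x N i) \<le> 1" by linarith+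
qed

lemma approx_diff_bound:
  assumes N: "0 < N" and a: "1 / (real N + 1) < a" "a < 1" and x: "0 \<le> x" "x \<le> 1"
  shows "\<bar>approx N a (Suc n) x - approx N a n x\<bar> \<le> (2 + 2 * real N) * a ^ n"
  using x
proof (induction n arbitrary: x)
  case 0
  obtain i where i: "i \<le> 2 * N" "node_x N i \<le> x" "x \<le> node_x N (Suc i)"
    using interval_cover 0 by metis
  define z where "z = real (2 * N + 1) * (x - node_x N i)"
  have z: "0 \<le> z" "z \<le> 1"
    using rescale_bounds[OF i(2,3)] by (simp_all only: z_def)
  have b: "0 < slope_b N a" "slope_b N a < a" using slope_b_bounds[OF N a] .
  define s where "s = (if even i then a else - slope_b N a)"
  have s: "\<bar>s\<bar> \<le> 1" unfolding s_def using b a by auto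
  have j: "real (i div 2) \<le> real N" using i(1) by simp
  have "\<bar>real (i div 2) * (a - slope_b N a)\<bar> \<le> real N * 1"
    unfolding abs_mult using j b a by (intro mult_mono) auto
  moreover have "node_y N a i = real (i div 2) * (a - slope_b N a) + (if even i then 0 else a)"
    by (simp add: node_y_def algebra_simps)
  ultimately have y: "\<bar>node_y N a i\<bar> \<le> real N + 1" using b a by (auto split: if_splits)
  have "\<bar>s * z\<bar> \<le> 1 * 1" unfolding abs_mult using s z by (intro mult_mono) auto
  moreover have "approx N a (Suc 0) x = node_y N a i + s * z"
    unfolding approx_Suc[OF N i] node_y_step s_def z_def by simp
  moreover have "approx N a 0 x = x" by simp
  moreover have "1 \<le> real N" using N by simp
  ultimately show ?case using y 0 by (simp del: approx.simps)
next
  case (Suc n)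
  obtain i where i: "i \<le> 2 * N" "node_x N i \<le> x" "x \<le> node_x N (Suc i)"
    using interval_cover Suc.prems by metis
  define z where "z = real (2 * N + 1) * (x - node_x N i)"
  have z: "0 \<le> z" "z \<le> 1"
    using rescale_bounds[OF i(2,3)] by (simp_all only: z_def)
  have b: "0 < slope_b N a" "slope_b N a < a" using slope_b_bounds[OF N a] .
  define s where "s = (if even i then a else - slope_b N a)"
  have s: "\<bar>s\<bar> \<le> a" unfolding s_def using b a by auto
  have "approx N a (Suc (Suc n)) x - approx N a (Suc n) x
          = s * (approx N a (Suc n) z - approx N a n z)"
    unfolding approx_Suc[OF N i] node_y_step s_def z_def by (simp only: right_diff_distrib add_diff_add diff_self add_0_left)
  then have "\<bar>approx N a (Suc (Suc n)) x - approx N a (Suc n) x\<bar>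
          = \<bar>s\<bar> * \<bar>approx N a (Suc n) z - approx N a n z\<bar>"
    by (simp only: abs_mult)
  also have "\<dots> \<le> a * ((2 + 2 * real N) * a ^ n)"
    using s Suc.IH[OF z] b by (intro mult_mono) auto
  finally show ?case by (simp only: power_Suc mult.left_commute)
qed

lemma approx_uniform_limit:
  assumes N: "0 < N" and a: "1 / (real N + 1) < a" "a < 1"
  shows "uniform_limit {0..1} (approx N a) (F_fun N a) sequentially"
proof -
  have a0: "0 < a" using slope_b_bounds[OF N a] by linarith
  have "uniform_limit {0..1} (\<lambda>n x. \<Sum>i<n. approx N a (Suc i) x - approx N a i x)
          (\<lambda>x. suminf (\<lambda>i. approx N a (Suc i) x - approx N a i x)) sequentially"
  proof (rule Weierstrass_m_test)
    show "norm (approx N a (Suc n) x - approx N a n x) \<le> (2 + 2 * real N) * a ^ n"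
      if "x \<in> {0..1}" for n x
      using approx_diff_bound[OF N a] that by (simp del: approx.simps)
    show "summable (\<lambda>n. (2 + 2 * real N) * a ^ n)"
      using a0 a by (intro summable_mult summable_geometric) auto
  qed
  then have "uniform_limit {0..1}
      (\<lambda>n x. x + (\<Sum>i<n. approx N a (Suc i) x - approx N a i x))
      (\<lambda>x. x + suminf (\<lambda>i. approx N a (Suc i) x - approx N a i x)) sequentially"
    by (intro uniform_limit_intros)
  moreover have "(\<lambda>n x. x + (\<Sum>i<n. approx N a (Suc i) x - approx N a i x)) = approx N a"
  proof (intro ext)
    fix n x
    show "x + (\<Sum>i<n. approx N a (Suc i) x - approx N a i x) = approx N a n x"
      using sum_lessThan_telescope[of "\<lambda>i. approx N a i x" n] by (simp del: approx.simps(2))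
  qed
  ultimately have u: "uniform_limit {0..1} (approx N a)
      (\<lambda>x. x + suminf (\<lambda>i. approx N a (Suc i) x - approx N a i x)) sequentially"
    by (simp only:)
  show ?thesis
  proof (rule uniform_limit_cong'[THEN iffD1, OF _ _ u])
    fix x :: real assume "x \<in> {0..1}"
    then have "(\<lambda>n. approx N a n x)
        \<longlonglongrightarrow> x + suminf (\<lambda>i. approx N a (Suc i) x - approx N a i x)"
      using tendsto_uniform_limitI[OF u] by blast
    then show "x + suminf (\<lambda>i. approx N a (Suc i) x - approx N a i x) = F_fun N a x"
      unfolding F_fun_def by (simp only: limI)
  qed simp
qed

section \<open>Base \<open>2 N + 1\<close> digits\<close>

text \<open>Digit sequences are indexed from \<open>1\<close>; the value at index \<open>0\<close> is irrelevant throughout.\<close>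

definition base_expansion :: "nat \<Rightarrow> real \<Rightarrow> (nat \<Rightarrow> nat) \<Rightarrow> bool" where
  "base_expansion N x \<xi> \<longleftrightarrow>
    (\<forall>i\<ge>1. \<xi> i \<le> 2 * N) \<and>
    (\<lambda>i. real (\<xi> (Suc i)) / real (2 * N + 1) ^ Suc i) sums x"

definition base_digits :: "nat \<Rightarrow> real \<Rightarrow> (nat \<Rightarrow> nat) \<Rightarrow> bool" where
  "base_digits N x \<xi> \<longleftrightarrow>
    base_expansion N x \<xi> \<and>
    ((\<exists>\<zeta>. base_expansion N x \<zeta> \<and> (\<exists>i\<ge>1. \<zeta> i \<noteq> \<xi> i)) \<longrightarrow>
      (\<forall>\<^sub>F i in sequentially. \<xi> i = 0))"

definition odd_count :: "(nat \<Rightarrow> nat) \<Rightarrow> enat" where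
  "odd_count \<xi> =
    (if finite {i. 1 \<le> i \<and> odd (\<xi> i)} then enat (card {i. 1 \<le> i \<and> odd (\<xi> i)}) else \<infinity>)"

text \<open>The following are real-valued because \<open>\<omega>\<^sub>i\<close> is a half-integer at odd digits.\<close>

definition omega :: "(nat \<Rightarrow> nat) \<Rightarrow> nat \<Rightarrow> real" where
  "omega \<xi> i = real (\<xi> i) / 2"

definition omega_bar :: "nat \<Rightarrow> (nat \<Rightarrow> nat) \<Rightarrow> nat \<Rightarrow> real" where
  "omega_bar N \<xi> i = real N - omega \<xi> i"

definition floor_digit :: "nat \<Rightarrow> real \<Rightarrow> nat \<Rightarrow> nat" where
  "floor_digit N x i =
    nat (\<lfloor>real (2 * N + 1) ^ i * x\<rfloor> - int (2 * N + 1) * \<lfloor>real (2 * N + 1) ^ (i - 1) * x\<rfloor>)"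

definition remainder :: "nat \<Rightarrow> real \<Rightarrow> (nat \<Rightarrow> nat) \<Rightarrow> nat \<Rightarrow> real" where
  "remainder N x \<xi> n =
    real (2 * N + 1) ^ n * (x - (\<Sum>i<n. real (\<xi> (Suc i)) / real (2 * N + 1) ^ Suc i))"

lemma remainder_0: "remainder N x \<xi> 0 = x"
  by (simp add: remainder_def)

lemma remainder_Suc:
  "remainder N x \<xi> (Suc n) = real (2 * N + 1) * remainder N x \<xi> n - real (\<xi> (Suc n))"
proof -
  have "real (2 * N + 1) ^ Suc n \<noteq> 0" by simp
  then show ?thesis
    unfolding remainder_def sum.lessThan_Suc
    by (simp only: right_diff_distrib distrib_left power_Suc) (simp add: field_simps)
qed

lemma remainder_bounds:
  assumes N: "0 < N" and e: "base_expansion N x \<xi>"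
  shows "0 \<le> remainder N x \<xi> n" "remainder N x \<xi> n \<le> 1"
proof -
  let ?B = "real (2 * N + 1)"
  define S where "S n = (\<Sum>i<n. real (\<xi> (Suc i)) / ?B ^ Suc i)" for n
  have B: "1 \<le> ?B" "0 < ?B" by simp_all
  have S: "S \<longlonglongrightarrow> x"
    using e unfolding base_expansion_def sums_def S_def by blast
  have "incseq S"
    unfolding S_def by (intro incseq_SucI) simp
  then have "S n \<le> x" using S by (rule incseq_le)
  then show "0 \<le> remainder N x \<xi> n" by (simp add: remainder_def S_def)
  have dec: "decseq (\<lambda>n. S n + 1 / ?B ^ n)"
  proof (rule decseq_SucI)
    fix n
    have "\<xi> (Suc n) \<le> 2 * N" using e by (auto simp: base_expansion_def)
    then have "real (\<xi> (Suc n)) + 1 \<le> ?B" by simp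
    then have "(real (\<xi> (Suc n)) + 1) / ?B ^ Suc n \<le> ?B / ?B ^ Suc n"
      using B by (intro divide_right_mono) auto
    also have "\<dots> = 1 / ?B ^ n" using B by simp
    finally show "S (Suc n) + 1 / ?B ^ Suc n \<le> S n + 1 / ?B ^ n"
      unfolding S_def sum.lessThan_Suc by (simp only: add_divide_distrib)
  qed
  have "(\<lambda>n. (1 / ?B) ^ n) \<longlonglongrightarrow> 0"
    using N by (intro LIMSEQ_realpow_zero) simp_all
  then have "(\<lambda>n. S n + (1 / ?B) ^ n) \<longlonglongrightarrow> x + 0"
    by (intro tendsto_add S)
  then have lim: "(\<lambda>n. S n + 1 / ?B ^ n) \<longlonglongrightarrow> x"
    by (simp only: power_one_over add_0_right)
  have "x \<le> S n + 1 / ?B ^ n" using decseq_ge[OF dec lim] .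
  then have "?B ^ n * (x - S n) \<le> ?B ^ n * (1 / ?B ^ n)"
    using B by (intro mult_left_mono) auto
  then show "remainder N x \<xi> n \<le> 1" using B by (simp add: remainder_def S_def)
qed

lemma remainder_zero_tail:
  assumes N: "0 < N" and e: "base_expansion N x \<xi>" and z: "remainder N x \<xi> k = 0"
    and "k \<le> n"
  shows "remainder N x \<xi> n = 0 \<and> \<xi> (Suc n) = 0"
  using \<open>k \<le> n\<close>
proof (induction n rule: dec_induct)
  case base
  then show ?case
    using z remainder_Suc[of N x \<xi> k] remainder_bounds(1)[OF N e, of "Suc k"] by simp
next
  case (step n)
  have "remainder N x \<xi> (Suc n) = 0"
    using step.IH remainder_Suc[of N x \<xi> n] by simp
  then show ?case
    using remainder_Suc[of N x \<xi> "Suc n"] remainder_bounds(1)[OF N e, of "Suc (Suc n)"] by simp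
qed

lemma remainder_one_tail:
  assumes N: "0 < N" and e: "base_expansion N x \<xi>" and z: "remainder N x \<xi> k = 1"
    and "k \<le> n"
  shows "remainder N x \<xi> n = 1 \<and> \<xi> (Suc n) = 2 * N"
proof -
  have d: "\<xi> (Suc m) \<le> 2 * N" for m using e by (simp add: base_expansion_def)
  have r: "\<xi> (Suc m) = 2 * N" if "remainder N x \<xi> m = 1" for m
    using that remainder_Suc[of N x \<xi> m] remainder_bounds(2)[OF N e, of "Suc m"] d[of m] by simp
  have "remainder N x \<xi> n = 1"
    using \<open>k \<le> n\<close>
  proof (induction n rule: dec_induct)
    case (step n)
    then show ?case using remainder_Suc[of N x \<xi> n] r[of n] by simp
  qed (use z in simp)
  then show ?thesis using r by blast
qed

lemma remainder_cong:
  assumes "\<And>i. i < n \<Longrightarrow> \<xi> (Suc i) = \<zeta> (Suc i)"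
  shows "remainder N x \<xi> n = remainder N x \<zeta> n"
  unfolding remainder_def using assms by simp

lemma floor_digit_Suc:
  "int (floor_digit N x (Suc n)) =
     \<lfloor>real (2 * N + 1) ^ Suc n * x\<rfloor> - int (2 * N + 1) * \<lfloor>real (2 * N + 1) ^ n * x\<rfloor>"
  "floor_digit N x (Suc n) \<le> 2 * N"
proof -
  let ?B = "real (2 * N + 1)"
  define t where "t = ?B ^ n * x"
  have "?B * real_of_int \<lfloor>t\<rfloor> \<le> ?B * t"
    by (intro mult_left_mono) simp_all
  then have "real_of_int (int (2 * N + 1) * \<lfloor>t\<rfloor>) \<le> ?B * t" by simp
  then have lo: "int (2 * N + 1) * \<lfloor>t\<rfloor> \<le> \<lfloor>?B * t\<rfloor>" by (simp only: le_floor_iff)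
  have "?B * t < ?B * (real_of_int \<lfloor>t\<rfloor> + 1)"
    by (intro mult_strict_left_mono) simp_all
  then have "?B * t < real_of_int (int (2 * N + 1) * (\<lfloor>t\<rfloor> + 1))" by simp
  then have hi: "\<lfloor>?B * t\<rfloor> < int (2 * N + 1) * (\<lfloor>t\<rfloor> + 1)" by (simp only: floor_less_iff)
  have t: "?B ^ Suc n * x = ?B * t" by (simp add: t_def)
  have d: "floor_digit N x (Suc n) = nat (\<lfloor>?B * t\<rfloor> - int (2 * N + 1) * \<lfloor>t\<rfloor>)"
    unfolding floor_digit_def t by (simp add: t_def)
  show "int (floor_digit N x (Suc n)) = \<lfloor>?B ^ Suc n * x\<rfloor> - int (2 * N + 1) * \<lfloor>?B ^ n * x\<rfloor>"
    unfolding d t using lo by (simp add: t_def)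
  show "floor_digit N x (Suc n) \<le> 2 * N"
    unfolding d using hi by (simp add: algebra_simps)
qed

lemma remainder_floor_digit:
  assumes "0 \<le> x" "x < 1"
  shows "remainder N x (floor_digit N x) n = frac (real (2 * N + 1) ^ n * x)"
proof (induction n)
  case 0
  have "\<lfloor>x\<rfloor> = 0" using assms by (simp add: floor_eq_iff)
  then show ?case by (simp add: remainder_0 frac_def)
next
  case (Suc n)
  have "real (floor_digit N x (Suc n)) = of_int (int (floor_digit N x (Suc n)))" by simp
  also have "\<dots> = of_int \<lfloor>real (2 * N + 1) ^ Suc n * x\<rfloor>
      - real (2 * N + 1) * of_int \<lfloor>real (2 * N + 1) ^ n * x\<rfloor>"
    unfolding floor_digit_Suc(1) by simp
  finally show ?case
    unfolding remainder_Suc Suc frac_def by (simp add: algebra_simps)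
qed

lemma base_expansion_floor_digit:
  assumes N: "0 < N" and x: "0 \<le> x" "x < 1"
  shows "base_expansion N x (floor_digit N x)"
proof -
  let ?B = "real (2 * N + 1)"
  define S where "S n = (\<Sum>i<n. real (floor_digit N x (Suc i)) / ?B ^ Suc i)" for n
  have B: "0 < ?B ^ n" for n by simp
  have r: "x - S n = frac (?B ^ n * x) / ?B ^ n" for n
    using remainder_floor_digit[OF x, of N n] B[of n]
    unfolding remainder_def S_def by (simp add: field_simps)
  have b: "0 \<le> x - S n" "x - S n \<le> (1 / ?B) ^ n" for n
    unfolding r power_one_over using B[of n] frac_lt_1[of "?B ^ n * x"]
    by (simp, intro divide_right_mono) simp_all
  have "(\<lambda>n. (1 / ?B) ^ n) \<longlonglongrightarrow> 0"
    using N by (intro LIMSEQ_realpow_zero) simp_all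
  then have "(\<lambda>n. x - S n) \<longlonglongrightarrow> 0"
    by (rule tendsto_sandwich[OF always_eventually always_eventually tendsto_const, rotated 2])
      (use b in blast)+
  then have "(\<lambda>n. x - (x - S n)) \<longlonglongrightarrow> x - 0" by (intro tendsto_intros)
  then have "S \<longlonglongrightarrow> x" by simp
  moreover have "floor_digit N x i \<le> 2 * N" if "1 \<le> i" for i
    using floor_digit_Suc(2)[of N x "i - 1"] that by simp
  ultimately show ?thesis
    unfolding base_expansion_def sums_def S_def by blast
qed

lemma base_expansion_differ:
  assumes N: "0 < N" and x: "0 \<le> x" "x < 1" and e: "base_expansion N x \<zeta>"
    and ne: "\<exists>i\<ge>1. \<zeta> i \<noteq> floor_digit N x i"
  shows "\<exists>k. \<forall>n\<ge>k. floor_digit N x (Suc n) = 0 \<and> \<zeta> (Suc n) = 2 * N"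
proof -
  let ?d = "floor_digit N x"
  note e' = base_expansion_floor_digit[OF N x]
  obtain i where "1 \<le> i" "\<zeta> i \<noteq> ?d i" using ne by blast
  then have ex: "\<exists>m. \<zeta> (Suc m) \<noteq> ?d (Suc m)" by (metis Suc_pred' zero_less_one less_le_trans)
  define m where "m = (LEAST m. \<zeta> (Suc m) \<noteq> ?d (Suc m))"
  have m: "\<zeta> (Suc m) \<noteq> ?d (Suc m)" unfolding m_def using ex by (rule LeastI_ex)
  have lt: "\<zeta> (Suc i) = ?d (Suc i)" if "i < m" for i
    using not_less_Least that unfolding m_def by blast
  have eq: "remainder N x \<zeta> m = remainder N x ?d m" using lt by (rule remainder_cong)
  have lt1: "remainder N x ?d (Suc m) < 1" unfolding remainder_floor_digit[OF x] by (rule frac_lt_1)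
  have diff: "remainder N x \<zeta> (Suc m) - remainder N x ?d (Suc m)
      = of_int (int (?d (Suc m)) - int (\<zeta> (Suc m)))"
    unfolding remainder_Suc eq by simp
  define q where "q = int (?d (Suc m)) - int (\<zeta> (Suc m))"
  have "q \<noteq> 0" using m by (simp add: q_def)
  moreover have "of_int q \<le> (1::real)" "(-1::real) < of_int q"
    using diff lt1 remainder_bounds[OF N e, of "Suc m"] remainder_bounds[OF N e', of "Suc m"]
    unfolding q_def by linarith+
  ultimately have "q = 1" by linarith
  then have "remainder N x \<zeta> (Suc m) = 1" "remainder N x ?d (Suc m) = 0"
    using diff remainder_bounds[OF N e, of "Suc m"] remainder_bounds[OF N e', of "Suc m"]
    unfolding q_def[symmetric] by simp_all
  then show ?thesis
    using remainder_one_tail[OF N e] remainder_zero_tail[OF N e'] by blast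
qed

text \<open>The digit sequence of a point of \<open>[0, 1)\<close> exists, is unique, and is the greedy one.\<close>

lemma base_digits_iff:
  assumes N: "0 < N" and x: "0 \<le> x" "x < 1"
  shows "base_digits N x \<xi> \<longleftrightarrow> (\<forall>i\<ge>1. \<xi> i = floor_digit N x i)"
proof
  assume d: "base_digits N x \<xi>"
  then have e: "base_expansion N x \<xi>" by (simp add: base_digits_def)
  show "\<forall>i\<ge>1. \<xi> i = floor_digit N x i"
  proof (rule ccontr)
    assume "\<not> ?thesis"
    then have ne: "\<exists>i\<ge>1. \<xi> i \<noteq> floor_digit N x i" by blast
    then have "\<forall>\<^sub>F i in sequentially. \<xi> i = 0"
      using d base_expansion_floor_digit[OF N x] unfolding base_digits_def by metis
    then obtain K where K: "\<xi> i = 0" if "K \<le> i" for i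
      by (auto simp: eventually_sequentially)
    obtain k where k: "\<xi> (Suc n) = 2 * N" if "k \<le> n" for n
      using base_expansion_differ[OF N x e ne] by blast
    have "\<xi> (Suc (max k K)) = 0" by (rule K) simp
    moreover have "\<xi> (Suc (max k K)) = 2 * N" by (rule k) simp
    ultimately show False using N by simp
  qed
next
  assume eq: "\<forall>i\<ge>1. \<xi> i = floor_digit N x i"
  then have e: "base_expansion N x \<xi>"
    using base_expansion_floor_digit[OF N x] by (simp add: base_expansion_def)
  moreover have "\<forall>\<^sub>F i in sequentially. \<xi> i = 0"
    if z: "base_expansion N x \<zeta>" "\<exists>i\<ge>1. \<zeta> i \<noteq> \<xi> i" for \<zeta>
  proof -
    have "\<exists>i\<ge>1. \<zeta> i \<noteq> floor_digit N x i" using z(2) eq by auto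
    then obtain k where k: "floor_digit N x (Suc n) = 0" if "k \<le> n" for n
      using base_expansion_differ[OF N x z(1)] by blast
    have "\<xi> i = 0" if "Suc k \<le> i" for i
      using k[of "i - 1"] eq that by simp
    then show ?thesis unfolding eventually_sequentially by blast
  qed
  ultimately show "base_digits N x \<xi>" unfolding base_digits_def by blast
qed

section \<open>Infinite derivatives and the growth condition\<close>

definition has_deriv_pinfty :: "(real \<Rightarrow> real) \<Rightarrow> real \<Rightarrow> bool" where
  "has_deriv_pinfty F x \<longleftrightarrow> filterlim (\<lambda>h. (F (x + h) - F x) / h) at_top (at 0)"

definition has_deriv_minfty :: "(real \<Rightarrow> real) \<Rightarrow> real \<Rightarrow> bool" where
  "has_deriv_minfty F x \<longleftrightarrow> filterlim (\<lambda>h. (F (x + h) - F x) / h) at_bot (at 0)"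

definition growth_condition :: "nat \<Rightarrow> real \<Rightarrow> (nat \<Rightarrow> real) \<Rightarrow> bool" where
  "growth_condition N a w \<longleftrightarrow>
    filterlim (\<lambda>n. (real (2 * N + 1) * a) ^ n * (1 - (\<Sum>j. a ^ Suc j * w (n + Suc j))))
      at_top sequentially"

end

theory Submission
  imports Defs
begin

text \<open>
  Put \<open>B = 2 N + 1\<close>, and let the cylinders of an expansion \<open>\<xi>\<close> of \<open>x\<close> be the nested intervals of
  length \<open>B\<^sup>-\<^sup>n\<close> of points that share the first \<open>n\<close> digits. On the \<open>n\<close>-th cylinder the graph of
  \<open>F\<close> is an affine copy of the whole graph, scaled vertically by a product \<open>S\<^sub>n\<close> with a factor \<open>a\<close>
  for each even digit and \<open>- b\<close> for each odd digit (\<open>F_on_cylinder\<close>). The increment of \<open>F\<close> over a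
  cylinder is \<open>S\<^sub>n\<close>, and \<open>x\<close> lies in it; an infinite derivative therefore forces the sign of \<open>S\<^sub>n\<close>
  to be eventually that of the derivative (\<open>infinite_slope_sign\<close>). So only finitely many digits are
  odd, and the parity of their number is the sign of the derivative.

  Suppose now that all digits from some place on are even, and that the expansion does not end in
  digits \<open>2 N\<close>. Let \<open>W n = (\<Sum>j\<ge>1. a\<^sup>j \<omega>\<^bsub>n+j\<^esub>)\<close>. Self-affinity turns \<open>F\<close> at the relative position of
  \<open>x\<close> in its \<open>n\<close>-th cylinder into \<open>((a - b) / a) W n\<close>. If \<open>\<xi> n < 2 N\<close>, the next piece to the right of
  the \<open>n\<close>-th cylinder belongs to an odd digit. In the copy of the whole graph that lies over the
  parent cylinder, the minimum over this piece and all later ones is attained at the right endpoint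
  of this piece, and it exceeds the value at \<open>x\<close> by \<open>(a - b) (1 - W n)\<close>. The size of \<open>S\<^sub>n\<close> is a
  constant times \<open>a\<^sup>n\<close>, so the difference quotient at this endpoint is comparable to
  \<open>(B a)\<^sup>n (1 - W n)\<close>. This gives the equivalence of an infinite right derivative with the growth
  condition: for every small \<open>h > 0\<close> some cylinder of \<open>x\<close> still contains \<open>x + h\<close> while the next one
  does not, and the minimum bounds the increment (\<open>right_slope_of_growth\<close>); the endpoints give the
  converse at all \<open>n\<close> with \<open>\<xi> n < 2 N\<close>, and along a run of digits \<open>2 N\<close> a positive value of
  \<open>(B a)\<^sup>n (1 - W n)\<close> only increases, because \<open>a (N + 1) > 1\<close> (\<open>growth_of_right_slope\<close>).

  The identity \<open>F (1 - x) = 1 - F x\<close> exchanges left and right, and replaces each digit \<open>\<xi> i\<close> by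
  \<open>2 N - \<xi> i\<close>, that is, \<open>\<omega>\<close> by its complement (\<open>infinite_slope_iff_growth\<close>). What remains are the
  points whose expansion ends in zeros. Such a point has a second expansion, ending in digits \<open>2 N\<close>,
  whose number of odd digits has the other parity, so no infinite derivative is possible
  (\<open>no_infinite_slope_at_node\<close>); and there the complementary growth condition fails, because its
  series is \<open>N a / (1 - a) > 1\<close> (\<open>no_growth_bar_at_node\<close>).
\<close>

section \<open>Self-affinity, range and symmetry\<close>

lemma convex_combination_lower:
  fixes u v t m :: real
  assumes "m \<le> u" "m \<le> v" "0 \<le> t" "t \<le> 1"
  shows "m \<le> u + (v - u) * t"
proof -
  have "0 \<le> (1 - t) * (u - m) + t * (v - m)"
    using assms by simp
  then show ?thesis by (simp add: algebra_simps)
qed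

lemma convex_combination_upper:
  fixes u v t m :: real
  assumes "u \<le> m" "v \<le> m" "0 \<le> t" "t \<le> 1"
  shows "u + (v - u) * t \<le> m"
  using convex_combination_lower[of "- m" "- u" "- v" t] assms by (simp add: algebra_simps)

locale self_affine =
  fixes N :: nat and a :: real
  assumes N: "0 < N" and a_gt: "1 / (real N + 1) < a" and a_lt: "a < 1"
begin

definition B :: real where "B = real (2 * N + 1)"

definition b :: real where "b = slope_b N a"

definition piece_slope :: "nat \<Rightarrow> real" where
  "piece_slope i = (if even i then a else - b)"

abbreviation F :: "real \<Rightarrow> real" where "F \<equiv> F_fun N a"

lemma B_gt_1: "1 < B"
  using N by (simp add: B_def)

lemma B_pos: "0 < B" "0 < B ^ n"
  using B_gt_1 by simp_all

lemma b_pos: "0 < b" and b_less: "b < a"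
  unfolding b_def using slope_b_bounds[OF N a_gt a_lt] by simp_all

lemma a_pos: "0 < a"
  using b_pos b_less by simp

lemma N_mult_step: "real N * (a - b) = 1 - a"
  using slope_b_eq[OF N, of a] by (simp add: b_def algebra_simps)

lemma node_y_even: "node_y N a (2 * k) = real k * (a - b)"
  by (simp add: node_y_def b_def)

lemma node_y_odd: "node_y N a (Suc (2 * k)) = real k * (a - b) + a"
  by (simp add: node_y_def b_def algebra_simps)

lemma node_y_diff: "node_y N a (Suc i) - node_y N a i = piece_slope i"
  using node_y_step[of N a i] by (simp add: piece_slope_def b_def)

text \<open>An odd node \<open>2 k + 1\<close> is a local maximum that lies \<open>b\<close> above the even node \<open>2 k + 2\<close> after it, so
  the even nodes, which increase by \<open>a - b\<close>, bound all later nodes from below.\<close>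

lemma node_y_lower: "real ((j + 1) div 2) * (a - b) \<le> node_y N a j"
proof (cases "even j")
  case True
  then obtain k where "j = 2 * k" by blast
  then show ?thesis by (simp add: node_y_even)
next
  case False
  then obtain k where "j = Suc (2 * k)" using oddE by fastforce
  then show ?thesis using b_pos by (simp add: node_y_odd) (simp add: algebra_simps)
qed

lemma node_y_reflect:
  assumes "j \<le> 2 * N + 1"
  shows "node_y N a (2 * N + 1 - j) = 1 - node_y N a j"
proof (cases "even j")
  case True
  then obtain k where k: "j = 2 * k" by blast
  then have e: "2 * N + 1 - j = Suc (2 * (N - k))" "k \<le> N" using assms by auto
  show ?thesis
    unfolding e(1) unfolding k node_y_even node_y_odd
    using N_mult_step e(2) by (simp add: of_nat_diff algebra_simps)
next
  case False
  then obtain k where k: "j = Suc (2 * k)" using oddE by fastforce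
  then have e: "2 * N + 1 - j = 2 * (N - k)" "k \<le> N" using assms by auto
  show ?thesis
    unfolding e(1) unfolding k node_y_even node_y_odd
    using N_mult_step e(2) by (simp add: of_nat_diff algebra_simps)
qed

lemma node_y_range:
  assumes "j \<le> 2 * N + 1"
  shows "0 \<le> node_y N a j" "node_y N a j \<le> 1"
proof -
  have nonneg: "0 \<le> node_y N a i" for i
    using node_y_lower[of i] b_less by (smt (verit) mult_nonneg_nonneg of_nat_0_le_iff)
  show "0 \<le> node_y N a j" by (rule nonneg)
  show "node_y N a j \<le> 1"
    using nonneg[of "2 * N + 1 - j"] node_y_reflect[OF assms] by simp
qed

lemma approx_range:
  assumes "0 \<le> z" "z \<le> 1"
  shows "0 \<le> approx N a n z \<and> approx N a n z \<le> 1"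
  using assms
proof (induction n arbitrary: z)
  case (Suc n)
  obtain i where i: "i \<le> 2 * N" "node_x N i \<le> z" "z \<le> node_x N (Suc i)"
    using interval_cover Suc.prems by metis
  show ?case
    unfolding approx_Suc[OF N i]
    using Suc.IH[OF rescale_bounds[OF i(2,3)]] node_y_range[of i] node_y_range[of "Suc i"] i(1)
    by (intro conjI convex_combination_lower convex_combination_upper) auto
qed simp

lemma approx_reflect:
  assumes "0 \<le> z" "z \<le> 1"
  shows "approx N a n (1 - z) = 1 - approx N a n z"
  using assms
proof (induction n arbitrary: z)
  case (Suc n)
  obtain i where i: "i \<le> 2 * N" "node_x N i \<le> z" "z \<le> node_x N (Suc i)"
    using interval_cover Suc.prems by metis
  define t where "t = real (2 * N + 1) * (z - node_x N i)"
  define i' where "i' = 2 * N - i"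
  have x': "node_x N i' = 1 - node_x N (Suc i)" "node_x N (Suc i') = 1 - node_x N i"
    using i(1) unfolding i'_def node_x_def by (simp_all add: of_nat_diff field_simps)
  have y': "node_y N a i' = 1 - node_y N a (Suc i)" "node_y N a (Suc i') = 1 - node_y N a i"
    using node_y_reflect[of "Suc i"] node_y_reflect[of i] i(1) unfolding i'_def
    by (simp_all add: Suc_diff_le)
  have "real (2 * N + 1) * (node_x N (Suc i) - node_x N i) = 1"
    by (simp add: node_x_def field_simps)
  then have t': "real (2 * N + 1) * (1 - z - node_x N i') = 1 - t"
    unfolding t_def x' by (simp add: algebra_simps)
  have "approx N a (Suc n) (1 - z)
      = node_y N a i' + (node_y N a (Suc i') - node_y N a i') * approx N a n (1 - t)"
    using i unfolding t'[symmetric] by (intro approx_Suc[OF N]) (simp_all add: x', simp add: i'_def)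
  also have "approx N a n (1 - t) = 1 - approx N a n t"
    unfolding t_def by (rule Suc.IH[OF rescale_bounds[OF i(2,3)]])
  finally show ?case
    unfolding approx_Suc[OF N i] t_def[symmetric] y' by (simp del: approx.simps add: algebra_simps)
qed simp

lemma approx_tendsto_F:
  assumes "0 \<le> z" "z \<le> 1"
  shows "(\<lambda>n. approx N a n z) \<longlonglongrightarrow> F z"
  using tendsto_uniform_limitI[OF approx_uniform_limit[OF N a_gt a_lt]] assms by simp

lemma F_range:
  assumes "0 \<le> z" "z \<le> 1"
  shows "0 \<le> F z" "F z \<le> 1"
  using approx_tendsto_F[OF assms] approx_range[OF assms]
  by (auto intro: LIMSEQ_le_const LIMSEQ_le_const2)

lemma F_reflect:
  assumes "0 \<le> z" "z \<le> 1"
  shows "F (1 - z) = 1 - F z"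
proof (rule LIMSEQ_unique)
  show "(\<lambda>n. approx N a n (1 - z)) \<longlonglongrightarrow> F (1 - z)"
    using assms by (intro approx_tendsto_F) simp_all
  show "(\<lambda>n. approx N a n (1 - z)) \<longlonglongrightarrow> 1 - F z"
    unfolding approx_reflect[OF assms] by (intro tendsto_intros approx_tendsto_F assms)
qed

lemma F_0: "F 0 = 0"
  unfolding F_fun_def approx_at_0 by simp

lemma F_1: "F 1 = 1"
  unfolding F_fun_def approx_at_1[OF N] by simp

lemma F_self_affine:
  assumes i: "i \<le> 2 * N" and z: "0 \<le> z" "z \<le> 1"
  shows "F ((real i + z) / B) = node_y N a i + piece_slope i * F z"
proof (rule LIMSEQ_unique)
  let ?x = "(real i + z) / B"
  have lo: "node_x N i \<le> ?x" and hi: "?x \<le> node_x N (Suc i)"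
    using z B_pos unfolding node_x_def B_def[symmetric] by (simp_all add: field_simps)
  have t: "real (2 * N + 1) * (?x - node_x N i) = z"
    using B_pos unfolding node_x_def B_def[symmetric] by (simp add: field_simps)
  have "real i + z \<le> B" using i z by (simp add: B_def)
  then have "0 \<le> ?x" "?x \<le> 1" using z B_pos by simp_all
  then show "(\<lambda>n. approx N a (Suc n) ?x) \<longlonglongrightarrow> F ?x"
    by (intro LIMSEQ_Suc[OF approx_tendsto_F])
  show "(\<lambda>n. approx N a (Suc n) ?x) \<longlonglongrightarrow> node_y N a i + piece_slope i * F z"
    unfolding approx_Suc[OF N i lo hi] node_y_diff t
    by (intro tendsto_intros approx_tendsto_F z)
qed

text \<open>To the right of the node \<open>2 k + 1\<close>, every value of \<open>F\<close> is a convex combination of the values at two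
  nodes of index at least \<open>2 k + 1\<close>. For
  \<open>k < N\<close> the bound is attained at the node \<open>2 k + 2\<close>.\<close>

lemma F_lower_beyond_node:
  assumes z: "real (2 * k + 1) / B \<le> z" "z \<le> 1"
  shows "real (k + 1) * (a - b) \<le> F z"
proof (cases "z = 1")
  case True
  have "real (2 * k + 1) \<le> B" using z True B_pos by (simp add: field_simps)
  then have "k \<le> N" unfolding B_def by simp
  then have "k * (a - b) \<le> N * (a - b)" using b_less by (intro mult_right_mono) simp_all
  then show ?thesis using N_mult_step b_pos by (simp add: True F_1 algebra_simps)
next
  case False
  have z0: "0 \<le> z" using z(1) B_pos by (smt (verit) divide_nonneg_pos of_nat_0_le_iff)
  define i where "i = nat \<lfloor>B * z\<rfloor>"
  have "0 \<le> B * z" using z0 B_pos by simp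
  then have lo: "real i \<le> B * z" and hi: "B * z < real i + 1"
    unfolding i_def by linarith+
  have "B * z < B" using False z(2) B_pos by simp
  then have i: "i \<le> 2 * N" using lo unfolding B_def by linarith
  have "real (2 * k + 1) \<le> B * z" using z(1) B_pos by (simp add: field_simps)
  then have ik: "2 * k + 1 \<le> i" using hi by linarith
  define t where "t = B * z - real i"
  have t: "0 \<le> t" "t \<le> 1" using lo hi by (simp_all add: t_def)
  have "F z = F ((real i + t) / B)" using B_pos by (simp add: t_def)
  also have "\<dots> = node_y N a i + (node_y N a (Suc i) - node_y N a i) * F t"
    unfolding F_self_affine[OF i t] node_y_diff ..
  also have "real (k + 1) * (a - b) \<le> \<dots>"
  proof (rule convex_combination_lower)
    have le: "real (k + 1) * (a - b) \<le> node_y N a j" if "2 * k + 1 \<le> j" for j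
    proof -
      have "k + 1 \<le> (j + 1) div 2" using that by simp
      then have "real (k + 1) * (a - b) \<le> real ((j + 1) div 2) * (a - b)"
        using b_less by (intro mult_right_mono of_nat_mono) simp_all
      then show ?thesis using node_y_lower[of j] by linarith
    qed
    show "real (k + 1) * (a - b) \<le> node_y N a i" "real (k + 1) * (a - b) \<le> node_y N a (Suc i)"
      using ik by (intro le; simp)+
  qed (use F_range[OF t] in simp_all)
  finally show ?thesis .
qed

section \<open>Cylinders of digit sequences\<close>

definition cylinder_left :: "(nat \<Rightarrow> nat) \<Rightarrow> nat \<Rightarrow> real" where
  "cylinder_left \<xi> n = (\<Sum>i<n. real (\<xi> (Suc i)) / B ^ Suc i)"

definition cylinder_slope :: "(nat \<Rightarrow> nat) \<Rightarrow> nat \<Rightarrow> real" where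
  "cylinder_slope \<xi> n = (\<Prod>i<n. piece_slope (\<xi> (Suc i)))"

text \<open>For an expansion \<open>\<xi>\<close> of \<open>x\<close>, this is the position of \<open>x\<close> relative to its cylinder of level \<open>n\<close>,
  a number in \<open>[0, 1]\<close>; see \<open>cylinder_decomposition\<close>.\<close>

abbreviation rem :: "real \<Rightarrow> (nat \<Rightarrow> nat) \<Rightarrow> nat \<Rightarrow> real" where
  "rem \<equiv> remainder N"

lemma rem_Suc: "rem x \<xi> (Suc n) = B * rem x \<xi> n - real (\<xi> (Suc n))"
  unfolding B_def by (rule remainder_Suc)

lemma cylinder_decomposition: "cylinder_left \<xi> n + rem x \<xi> n / B ^ n = x"
  using B_gt_1 unfolding remainder_def cylinder_left_def B_def[symmetric]
  by simp

lemma cylinder_slope_Suc: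
  "cylinder_slope \<xi> (Suc n) = cylinder_slope \<xi> n * piece_slope (\<xi> (Suc n))"
  by (simp add: cylinder_slope_def)

lemma piece_slope_nonzero: "piece_slope i \<noteq> 0"
  using a_pos b_pos by (simp add: piece_slope_def)

lemma cylinder_slope_nonzero: "cylinder_slope \<xi> n \<noteq> 0"
  by (simp add: cylinder_slope_def piece_slope_nonzero)

text \<open>The graph over a cylinder is an affine copy of the whole graph: iterate the self-affinity from the
  innermost digit outwards.\<close>

lemma F_on_cylinder:
  assumes d: "\<And>i. \<xi> (Suc i) \<le> 2 * N" and z: "0 \<le> z" "z \<le> 1"
  shows "F (cylinder_left \<xi> n + z / B ^ n) = F (cylinder_left \<xi> n) + cylinder_slope \<xi> n * F z"
  using z
proof (induction n arbitrary: z)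
  case 0
  then show ?case by (simp add: cylinder_left_def cylinder_slope_def F_0)
next
  case (Suc n)
  have step: "F (cylinder_left \<xi> (Suc n) + t / B ^ Suc n) = F (cylinder_left \<xi> n)
      + cylinder_slope \<xi> n * (node_y N a (\<xi> (Suc n)) + piece_slope (\<xi> (Suc n)) * F t)"
    if t: "0 \<le> t" "t \<le> 1" for t
  proof -
    let ?u = "(real (\<xi> (Suc n)) + t) / B"
    have "real (\<xi> (Suc n)) + t \<le> B" using d[of n] t by (simp add: B_def)
    then have u: "0 \<le> ?u" "?u \<le> 1" using t B_pos by simp_all
    have "cylinder_left \<xi> (Suc n) + t / B ^ Suc n = cylinder_left \<xi> n + ?u / B ^ n"
      using B_pos by (simp add: cylinder_left_def add_divide_distrib)
    then show ?thesis using Suc.IH[OF u] F_self_affine[OF d t] by simp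
  qed
  show ?case
    using step[of 0] step[OF Suc.prems] by (simp add: F_0 cylinder_slope_Suc algebra_simps)
qed

lemma cylinder_slope_even_tail:
  assumes "\<And>i. n0 < i \<Longrightarrow> even (\<xi> i)" "n0 \<le> n"
  shows "cylinder_slope \<xi> n = cylinder_slope \<xi> n0 * a ^ (n - n0)"
  using assms(2)
proof (induction n rule: dec_induct)
  case (step n)
  then show ?case
    using assms(1)[of "Suc n"] by (simp add: cylinder_slope_Suc piece_slope_def Suc_diff_le)
qed simp

lemma F_remainder_step:
  assumes d: "\<xi> (Suc n) \<le> 2 * N" "even (\<xi> (Suc n))"
    and r: "0 \<le> rem x \<xi> (Suc n)" "rem x \<xi> (Suc n) \<le> 1"
  shows "F (rem x \<xi> n) = (a - b) * omega \<xi> (Suc n) + a * F (rem x \<xi> (Suc n))"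
proof -
  obtain k where k: "\<xi> (Suc n) = 2 * k" using d(2) by blast
  have "rem x \<xi> n = (real (\<xi> (Suc n)) + rem x \<xi> (Suc n)) / B"
    using rem_Suc[of x \<xi> n] B_pos by (simp add: field_simps)
  then show ?thesis
    using F_self_affine[OF d(1) r] d(2) by (simp add: piece_slope_def k node_y_even omega_def)
qed

definition tail_sum :: "(nat \<Rightarrow> real) \<Rightarrow> nat \<Rightarrow> real" where
  "tail_sum w n = (\<Sum>j. a ^ Suc j * w (n + Suc j))"

lemma growth_condition_tail_sum:
  "growth_condition N a w \<longleftrightarrow>
    filterlim (\<lambda>n. (B * a) ^ n * (1 - tail_sum w n)) at_top sequentially"
  by (simp add: growth_condition_def tail_sum_def B_def)

text \<open>An even digit \<open>2 k\<close> contributes \<open>k (a - b)\<close> and rescales by \<open>a\<close>. Iterating over the even tail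
  gives a partial sum with an error \<open>a\<^sup>m F (\<dots>)\<close>, which tends to \<open>0\<close> because \<open>F\<close> is bounded.\<close>

lemma F_remainder_tail_sum:
  assumes d: "\<And>i. \<xi> (Suc i) \<le> 2 * N" and ev: "\<And>i. n < i \<Longrightarrow> even (\<xi> i)"
    and r: "\<And>i. 0 \<le> rem x \<xi> i" "\<And>i. rem x \<xi> i \<le> 1"
  shows "a * F (rem x \<xi> n) = (a - b) * tail_sum (omega \<xi>) n"
proof -
  have partial: "F (rem x \<xi> n) =
      (a - b) * (\<Sum>j<m. a ^ j * omega \<xi> (n + Suc j)) + a ^ m * F (rem x \<xi> (n + m))" for m
  proof (induction m)
    case (Suc m)
    have "F (rem x \<xi> (n + m))
        = (a - b) * omega \<xi> (n + Suc m) + a * F (rem x \<xi> (n + Suc m))"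
      using F_remainder_step[of \<xi> "n + m" x] d ev r by simp
    then show ?case
      using Suc.IH by (simp only: sum.lessThan_Suc power_Suc) (simp only: algebra_simps)
  qed simp
  have lim0: "(\<lambda>m. a ^ m * F (rem x \<xi> (n + m))) \<longlonglongrightarrow> 0"
  proof (rule tendsto_sandwich[of "\<lambda>_. 0" _ _ "\<lambda>m. a ^ m"])
    show "(\<lambda>m. a ^ m) \<longlonglongrightarrow> 0" using a_pos a_lt by (intro LIMSEQ_realpow_zero) simp_all
    show "\<forall>\<^sub>F m in sequentially. a ^ m * F (rem x \<xi> (n + m)) \<le> a ^ m"
      using a_pos F_range[OF r] by (intro always_eventually allI mult_left_le) simp_all
  qed (use a_pos F_range[OF r] in simp_all)
  have "(\<lambda>m. F (rem x \<xi> n) - a ^ m * F (rem x \<xi> (n + m))) \<longlonglongrightarrow> F (rem x \<xi> n) - 0"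
    by (intro tendsto_intros lim0)
  then have "(\<lambda>m. a / (a - b) * (F (rem x \<xi> n) - a ^ m * F (rem x \<xi> (n + m))))
      \<longlonglongrightarrow> a / (a - b) * (F (rem x \<xi> n) - 0)"
    by (rule tendsto_mult_left)
  moreover have "a / (a - b) * (F (rem x \<xi> n) - a ^ m * F (rem x \<xi> (n + m)))
      = (\<Sum>j<m. a ^ Suc j * omega \<xi> (n + Suc j))" for m
  proof -
    have "F (rem x \<xi> n) - a ^ m * F (rem x \<xi> (n + m))
        = (a - b) * (\<Sum>j<m. a ^ j * omega \<xi> (n + Suc j))"
      using partial[of m] by linarith
    moreover have "a / (a - b) * ((a - b) * t) = a * t" for t
      using b_less by simp
    ultimately show ?thesis by (simp only: sum_distrib_left power_Suc mult.assoc)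
  qed
  ultimately have "(\<lambda>j. a ^ Suc j * omega \<xi> (n + Suc j)) sums (a / (a - b) * F (rem x \<xi> n))"
    unfolding sums_def by simp
  then have "tail_sum (omega \<xi>) n = a / (a - b) * F (rem x \<xi> n)"
    unfolding tail_sum_def by (rule sums_unique[symmetric])
  then show ?thesis using b_less by simp
qed


section \<open>Infinite slopes and secants over cylinders\<close>

text \<open>With \<open>\<sigma> = 1\<close> or \<open>\<sigma> = - 1\<close> for the sign and \<open>G\<close> for the side, this treats the derivatives \<open>\<infinity>\<close> and
  \<open>- \<infinity>\<close>, one-sided and two-sided, at once.\<close>

definition infinite_slope :: "real \<Rightarrow> real \<Rightarrow> real filter \<Rightarrow> bool" where
  "infinite_slope \<sigma> x G \<longleftrightarrow> filterlim (\<lambda>h. \<sigma> * ((F (x + h) - F x) / h)) at_top G"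

lemma has_deriv_pinfty_iff: "has_deriv_pinfty F x \<longleftrightarrow> infinite_slope 1 x (at 0)"
  by (simp add: has_deriv_pinfty_def infinite_slope_def)

lemma has_deriv_minfty_iff: "has_deriv_minfty F x \<longleftrightarrow> infinite_slope (- 1) x (at 0)"
  unfolding has_deriv_minfty_def infinite_slope_def filterlim_uminus_at_bot
  by (simp only: mult_minus1)

lemma infinite_slope_two_sided:
  "infinite_slope \<sigma> x (at 0) \<longleftrightarrow> infinite_slope \<sigma> x (at_left 0) \<and> infinite_slope \<sigma> x (at_right 0)"
  by (simp add: infinite_slope_def filterlim_at_split)

lemma const_over_power_tendsto: "(\<lambda>n. c / B ^ n) \<longlonglongrightarrow> 0"
  using tendsto_mult_right_zero[OF LIMSEQ_inverse_realpow_zero[OF B_gt_1], of c]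
  by (simp add: field_simps)

text \<open>The increment of \<open>F\<close> over a cylinder is the sum of the increments to the left and to the right of
  \<open>x\<close>, each of which has the sign \<open>\<sigma>\<close> once the cylinder is short, unless \<open>x\<close> is the endpoint on that
  side. The hypotheses admit every
  expansion of \<open>x\<close>, not only the one ending in zeros; a point with two expansions is treated by
  comparing both.\<close>

lemma infinite_slope_sign:
  assumes d: "\<And>i. \<xi> (Suc i) \<le> 2 * N"
    and r: "\<And>n. 0 \<le> rem x \<xi> n" "\<And>n. rem x \<xi> n \<le> 1"
    and inf: "infinite_slope \<sigma> x (at 0)"
  shows "\<forall>\<^sub>F n in sequentially. 0 < \<sigma> * cylinder_slope \<xi> n"
proof -
  have "\<forall>\<^sub>F h in at 0. 0 < \<sigma> * ((F (x + h) - F x) / h)"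
    using inf unfolding infinite_slope_def filterlim_at_top_dense by blast
  then obtain e where e: "0 < e"
    and pos: "\<And>h. h \<noteq> 0 \<Longrightarrow> \<bar>h\<bar> < e \<Longrightarrow> 0 < \<sigma> * ((F (x + h) - F x) / h)"
    unfolding eventually_at by (auto simp: dist_real_def)
  have "\<forall>\<^sub>F n in sequentially. 1 / B ^ n < e"
    using order_tendstoD(2)[OF const_over_power_tendsto e] .
  then show ?thesis
  proof eventually_elim
    case (elim n)
    \<comment> \<open>\<open>p\<close> and \<open>q\<close> are the distances from \<open>x\<close> to the two endpoints of the cylinder.\<close>
    define p q where "p = rem x \<xi> n / B ^ n" and "q = (1 - rem x \<xi> n) / B ^ n"
    have pq: "0 \<le> p" "0 \<le> q" "p + q = 1 / B ^ n"
      using r[of n] B_pos(2)[of n] by (simp_all add: p_def q_def flip: add_divide_distrib)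
    have left: "cylinder_left \<xi> n = x - p"
      using cylinder_decomposition[of \<xi> n x] by (simp add: p_def)
    have "cylinder_left \<xi> n + 1 / B ^ n = x + q" using left pq(3) by linarith
    then have slope: "cylinder_slope \<xi> n = (F (x + q) - F x) + (F x - F (x - p))"
      using F_on_cylinder[where \<xi> = \<xi> and z = 1 and n = n] d \<open>_ = x + q\<close>
      unfolding left by (simp add: F_1)
    have right_part: "0 < \<sigma> * (F (x + q) - F x)" if "0 < q"
      using pos[of q] that pq elim by (simp add: zero_less_divide_iff zero_less_mult_iff)
    have left_part: "0 < \<sigma> * (F x - F (x - p))" if "0 < p"
    proof -
      have "\<sigma> * ((F (x + - p) - F x) / - p) = \<sigma> * (F x - F (x - p)) / p"
        using that by (simp add: field_simps)
      then have "0 < \<sigma> * (F x - F (x - p)) / p"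
        using pos[of "- p"] that pq elim by simp
      then show ?thesis using that by (simp add: zero_less_divide_iff)
    qed
    have "0 < p \<or> 0 < q" using pq B_pos(2)[of n] by (smt (verit) zero_less_divide_1_iff)
    moreover have "0 \<le> \<sigma> * (F (x + q) - F x)"
      using right_part pq(2) by (cases "q = 0") auto
    moreover have "0 \<le> \<sigma> * (F x - F (x - p))"
      using left_part pq(1) by (cases "p = 0") auto
    ultimately show "0 < \<sigma> * cylinder_slope \<xi> n"
      unfolding slope distrib_left using right_part left_part by linarith
  qed
qed

section \<open>The right-hand derivative\<close>

lemma F_remainder_even_tail:
  assumes e: "base_expansion N x \<xi>" and ev: "\<And>i. m < i \<Longrightarrow> even (\<xi> i)"
    and k: "\<xi> (Suc m) = 2 * k"
  shows "F (rem x \<xi> m) = (a - b) * (real k + tail_sum (omega \<xi>) (Suc m))"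
proof -
  have d: "\<xi> (Suc i) \<le> 2 * N" for i using e by (simp add: base_expansion_def)
  note r = remainder_bounds[OF N e]
  have "F (rem x \<xi> m) = (a - b) * omega \<xi> (Suc m) + a * F (rem x \<xi> (Suc m))"
    using F_remainder_step[OF d _ r] k by simp
  also have "a * F (rem x \<xi> (Suc m)) = (a - b) * tail_sum (omega \<xi>) (Suc m)"
    using F_remainder_tail_sum[OF d _ r] ev by simp
  finally show ?thesis by (simp add: omega_def k algebra_simps)
qed

text \<open>The increment from \<open>x\<close> to the point \<open>y\<close> at relative position \<open>z\<close> in the cylinder of level \<open>m\<close>. All
  scaling factors beyond \<open>n0\<close> equal \<open>a\<close>, hence the constant \<open>\<bar>S\<^bsub>n0\<^esub>\<bar> / a\<^bsup>n0\<^esup>\<close>.\<close>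

lemma F_increment_in_cylinder:
  assumes e: "base_expansion N x \<xi>" and ev: "\<And>i. n0 < i \<Longrightarrow> even (\<xi> i)" and m: "n0 \<le> m"
    and k: "\<xi> (Suc m) = 2 * k" and z: "0 \<le> z" "z \<le> 1"
    and y: "y = x + (z - rem x \<xi> m) / B ^ m"
  shows "sgn (cylinder_slope \<xi> n0) * (F y - F x)
    = \<bar>cylinder_slope \<xi> n0\<bar> / a ^ n0 * a ^ m
      * (F z - (a - b) * (real k + tail_sum (omega \<xi>) (Suc m)))"
proof -
  have d: "\<xi> (Suc i) \<le> 2 * N" for i using e by (simp add: base_expansion_def)
  note r = remainder_bounds[OF N e]
  have x: "cylinder_left \<xi> m + rem x \<xi> m / B ^ m = x" by (rule cylinder_decomposition)
  then have "y = cylinder_left \<xi> m + z / B ^ m" unfolding y by (simp add: diff_divide_distrib)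
  then have "F y - F x = cylinder_slope \<xi> m * (F z - F (rem x \<xi> m))"
    using F_on_cylinder[where \<xi> = \<xi> and n = m, OF d z]
      F_on_cylinder[where \<xi> = \<xi> and n = m and z = "rem x \<xi> m", OF d r]
    unfolding x by (simp add: algebra_simps)
  also have "cylinder_slope \<xi> m = cylinder_slope \<xi> n0 * (a ^ m / a ^ n0)"
    using cylinder_slope_even_tail[of n0 \<xi> m, OF ev m] m a_pos by (simp add: power_diff)
  also have "F (rem x \<xi> m) = (a - b) * (real k + tail_sum (omega \<xi>) (Suc m))"
    using ev m by (intro F_remainder_even_tail[OF e _ k]) simp
  finally have "sgn (cylinder_slope \<xi> n0) * (F y - F x)
      = (sgn (cylinder_slope \<xi> n0) * cylinder_slope \<xi> n0) * (a ^ m / a ^ n0)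
        * (F z - (a - b) * (real k + tail_sum (omega \<xi>) (Suc m)))"
    by (simp add: mult.assoc)
  then show ?thesis by (simp add: abs_sgn mult.commute)
qed

lemma remainder_less_1:
  assumes e: "base_expansion N x \<xi>" and nt: "\<exists>\<^sub>\<infinity>n. \<xi> n \<noteq> 2 * N"
  shows "rem x \<xi> n < 1"
proof (rule ccontr)
  assume "\<not> ?thesis"
  then have "rem x \<xi> n = 1" using remainder_bounds(2)[OF N e, of n] by simp
  then have top: "\<xi> (Suc m) = 2 * N" if "n \<le> m" for m
    using remainder_one_tail[OF N e] that by blast
  obtain i where "Suc n \<le> i" "\<xi> i \<noteq> 2 * N" using nt unfolding INFM_nat_le by blast
  then show False using top[of "i - 1"] by (cases i) simp_all
qed

text \<open>For small \<open>h > 0\<close> there is a level \<open>m\<close> such that \<open>x + h\<close> lies in the cylinder of level \<open>m\<close> but beyond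
  that of level \<open>m + 1\<close>. Then \<open>h \<le> B\<^sup>-\<^sup>m\<close>, and \<open>F_lower_beyond_node\<close> bounds the increment from below
  by a multiple of \<open>a\<^sup>m (1 - W (m + 1))\<close>.\<close>

lemma right_slope_of_growth:
  assumes e: "base_expansion N x \<xi>" and ev: "\<And>i. n0 < i \<Longrightarrow> even (\<xi> i)"
    and nt: "\<exists>\<^sub>\<infinity>n. \<xi> n \<noteq> 2 * N" and growth: "growth_condition N a (omega \<xi>)"
  shows "infinite_slope (sgn (cylinder_slope \<xi> n0)) x (at_right 0)"
  unfolding infinite_slope_def filterlim_at_top_gt[where c = 0]
proof (intro allI impI)
  fix Z :: real assume Z: "0 < Z"
  define C where "C = \<bar>cylinder_slope \<xi> n0\<bar> / a ^ n0"
  define K where "K = Z * (B * a) / (C * (a - b))"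
  let ?w = "tail_sum (omega \<xi>)"
  have C: "0 < C" using cylinder_slope_nonzero a_pos by (simp add: C_def)
  have K: "0 < K" using Z C a_pos b_less B_pos by (simp add: K_def)
  have "\<forall>\<^sub>F n in sequentially. K \<le> (B * a) ^ n * (1 - ?w n)"
    using growth unfolding growth_condition_tail_sum filterlim_at_top by blast
  then obtain n' where n': "\<And>n. n' \<le> n \<Longrightarrow> K \<le> (B * a) ^ n * (1 - ?w n)"
    unfolding eventually_sequentially by blast
  define n1 where "n1 = max n' n0"
  note r = remainder_bounds[OF N e]
  \<comment> \<open>Below \<open>\<delta>\<close>, the point \<open>x + h\<close> is still in the cylinder of level \<open>n1\<close>, which ends to the right of \<open>x\<close>.\<close>
  define \<delta> where "\<delta> = (1 - rem x \<xi> n1) / B ^ n1"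
  have "0 < \<delta>" using remainder_less_1[OF e nt] B_pos by (simp add: \<delta>_def)
  moreover have "Z \<le> sgn (cylinder_slope \<xi> n0) * ((F (x + h) - F x) / h)"
    if h: "0 < h" "h < \<delta>" for h
  proof -
    \<comment> \<open>\<open>h * B ^ m \<le> 1 - rem x \<xi> m\<close> says that \<open>x + h\<close> lies in the cylinder of level \<open>m\<close>.\<close>
    have "\<exists>m\<ge>n1. h * B ^ m \<le> 1 - rem x \<xi> m \<and> 1 - rem x \<xi> (Suc m) < h * B ^ Suc m"
    proof (rule ccontr)
      assume "\<not> ?thesis"
      then have next_below: "h * B ^ Suc m \<le> 1 - rem x \<xi> (Suc m)"
        if "n1 \<le> m" "h * B ^ m \<le> 1 - rem x \<xi> m" for m
        using that by force
      have below: "h * B ^ n \<le> 1 - rem x \<xi> n" if "n1 \<le> n" for n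
        using that
      proof (induction n rule: dec_induct)
        case base
        show ?case using h(2) B_pos(2)[of n1] by (simp add: \<delta>_def field_simps)
      next
        case (step n)
        then show ?case using next_below by blast
      qed
      obtain n where n: "1 / h < B ^ n" using real_arch_pow[OF B_gt_1] by blast
      also have "B ^ n \<le> B ^ max n n1" using B_gt_1 by (intro power_increasing) simp_all
      finally have "1 < h * B ^ max n n1" using h(1) by (simp add: field_simps)
      then show False using below[of "max n n1"] r(1)[of "max n n1"] by simp
    qed
    then obtain m where m: "n1 \<le> m" "h * B ^ m \<le> 1 - rem x \<xi> m"
      "1 - rem x \<xi> (Suc m) < h * B ^ Suc m" by blast
    have nm: "n0 \<le> m" "n' \<le> Suc m" using m(1) by (simp_all add: n1_def)
    obtain k where k: "\<xi> (Suc m) = 2 * k" using ev[of "Suc m"] nm by auto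
    define z where "z = rem x \<xi> m + h * B ^ m"
    have z: "0 \<le> z" "z \<le> 1" using r(1)[of m] m(2) h B_pos by (simp_all add: z_def)
    have y: "x + h = x + (z - rem x \<xi> m) / B ^ m" using B_gt_1 by (simp add: z_def)
    have "real (2 * k + 1) \<le> B * z"
      using m(3) rem_Suc[of x \<xi> m] by (simp add: z_def k algebra_simps)
    then have "real (2 * k + 1) / B \<le> z" using B_pos by (simp add: field_simps)
    then have "real (k + 1) * (a - b) \<le> F z" using z(2) by (rule F_lower_beyond_node)
    then have low: "(a - b) * (1 - ?w (Suc m)) \<le> F z - (a - b) * (real k + ?w (Suc m))"
      by (simp add: algebra_simps)
    have K_le: "K \<le> (B * a) ^ Suc m * (1 - ?w (Suc m))" using n'[OF nm(2)] .
    have "0 < (B * a) ^ Suc m" using B_pos a_pos by simp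
    then have w: "0 < 1 - ?w (Suc m)" using K K_le by (smt (verit) zero_less_mult_pos)
    have "Z = C * (a - b) / (B * a) * K" using C b_less B_pos a_pos by (simp add: K_def)
    also have "\<dots> \<le> C * (a - b) / (B * a) * ((B * a) ^ Suc m * (1 - ?w (Suc m)))"
      using K_le C b_less B_pos a_pos by (intro mult_left_mono) simp_all
    also have "\<dots> = (C * a ^ m * ((a - b) * (1 - ?w (Suc m)))) * B ^ m"
      using B_pos a_pos by (simp add: power_mult_distrib)
    also have "\<dots> \<le> (C * a ^ m * ((a - b) * (1 - ?w (Suc m)))) * (1 / h)"
    proof (rule mult_left_mono)
      show "B ^ m \<le> 1 / h" using m(2) r(1)[of m] h(1) by (simp add: field_simps)
      show "0 \<le> C * a ^ m * ((a - b) * (1 - ?w (Suc m)))" using w C b_less a_pos by simp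
    qed
    also have "\<dots> \<le> (C * a ^ m * (F z - (a - b) * (real k + ?w (Suc m)))) * (1 / h)"
      using low h(1) C a_pos by (intro mult_right_mono mult_left_mono) simp_all
    also have "\<dots> = sgn (cylinder_slope \<xi> n0) * ((F (x + h) - F x) / h)"
      using F_increment_in_cylinder[OF e ev nm(1) k z y] by (simp add: C_def)
    finally show ?thesis .
  qed
  ultimately show "\<forall>\<^sub>F h in at_right 0. Z \<le> sgn (cylinder_slope \<xi> n0) * ((F (x + h) - F x) / h)"
    unfolding eventually_at_right_field by blast
qed

text \<open>If \<open>\<xi> n = 2 k < 2 N\<close>, the right endpoint of the neighbouring piece \<open>2 k + 1\<close> is in the same parent
  cylinder and at distance between \<open>B\<^sup>-\<^sup>n\<close> and \<open>2 B\<^sup>-\<^sup>n\<close> from \<open>x\<close>, and its difference quotient is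
  comparable to \<open>(B a)\<^sup>n (1 - W n)\<close>. At digits \<open>2 N\<close> that neighbour is outside the parent cylinder;
  there the bound is inherited from the preceding index.\<close>

lemma growth_of_right_slope:
  assumes e: "base_expansion N x \<xi>" and ev: "\<And>i. n0 < i \<Longrightarrow> even (\<xi> i)"
    and nt: "\<exists>\<^sub>\<infinity>n. \<xi> n \<noteq> 2 * N"
    and inf: "infinite_slope (sgn (cylinder_slope \<xi> n0)) x (at_right 0)"
  shows "growth_condition N a (omega \<xi>)"
  unfolding growth_condition_tail_sum filterlim_at_top_gt[where c = 0]
proof (intro allI impI)
  fix K :: real assume K: "0 < K"
  define C where "C = \<bar>cylinder_slope \<xi> n0\<bar> / a ^ n0"
  \<comment> \<open>The bound on difference quotients that yields exactly \<open>K\<close> after clearing constants.\<close>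
  define Z where "Z = K * C * (a - b) / a"
  let ?w = "tail_sum (omega \<xi>)"
  let ?g = "\<lambda>n. (B * a) ^ n * (1 - ?w n)"
  have C: "0 < C" using cylinder_slope_nonzero a_pos by (simp add: C_def)
  have d: "\<xi> (Suc i) \<le> 2 * N" for i using e by (simp add: base_expansion_def)
  note r = remainder_bounds[OF N e]
  have "\<forall>\<^sub>F h in at_right 0. Z \<le> sgn (cylinder_slope \<xi> n0) * ((F (x + h) - F x) / h)"
    using inf unfolding infinite_slope_def filterlim_at_top by blast
  then obtain \<delta> where \<delta>: "0 < \<delta>" and steep: "\<And>h. 0 < h \<Longrightarrow> h < \<delta> \<Longrightarrow>
      Z \<le> sgn (cylinder_slope \<xi> n0) * ((F (x + h) - F x) / h)"
    unfolding eventually_at_right_field by blast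
  have "\<forall>\<^sub>F n in sequentially. 2 / B ^ n < \<delta>"
    using order_tendstoD(2)[OF const_over_power_tendsto \<delta>] .
  then obtain n1 where n1: "\<And>n. n1 \<le> n \<Longrightarrow> 2 / B ^ n < \<delta>"
    unfolding eventually_sequentially by blast
  have direct: "K \<le> ?g (Suc m)" if m: "max n0 n1 \<le> m" and top: "\<xi> (Suc m) \<noteq> 2 * N" for m
  proof -
    have nm: "n0 \<le> m" "n1 \<le> Suc m" using m by simp_all
    obtain k where k: "\<xi> (Suc m) = 2 * k" using ev[of "Suc m"] nm by auto
    have kN: "2 * (k + 1) \<le> 2 * N" using top d[of m] k by simp
    define z where "z = real (2 * (k + 1)) / B"
    have "real (2 * (k + 1)) \<le> B" using kN unfolding B_def by linarith
    then have z: "0 \<le> z" "z \<le> 1" using B_pos by (simp_all add: z_def)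
    have Bz: "B * z = 2 * real k + 2" using B_pos by (simp add: z_def)
    have "F z = real (k + 1) * (a - b)"
      using F_self_affine[OF kN, of 0] unfolding node_y_even by (simp add: z_def F_0)
    then have Fz: "F z - (a - b) * (real k + ?w (Suc m)) = (a - b) * (1 - ?w (Suc m))"
      by (simp add: algebra_simps)
    \<comment> \<open>The step from \<open>x\<close> to the point at relative position \<open>z\<close>, the node \<open>2 k + 2\<close> of the parent cylinder.\<close>
    define h where "h = (2 - rem x \<xi> (Suc m)) / B ^ Suc m"
    have "B * (z - rem x \<xi> m) = 2 - rem x \<xi> (Suc m)"
      using rem_Suc[of x \<xi> m] Bz by (simp add: k right_diff_distrib)
    then have "h = (B * (z - rem x \<xi> m)) / B ^ Suc m" by (simp add: h_def)
    then have y: "x + h = x + (z - rem x \<xi> m) / B ^ m" using B_pos by simp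
    have h1: "1 / B ^ Suc m \<le> h" "h \<le> 2 / B ^ Suc m"
      unfolding h_def using r[of "Suc m"] B_pos by (intro divide_right_mono; simp)+
    have h0: "0 < h" using h1(1) B_pos(2)[of "Suc m"] by (smt (verit) zero_less_divide_1_iff)
    have "Z \<le> sgn (cylinder_slope \<xi> n0) * ((F (x + h) - F x) / h)"
      using h0 h1(2) n1[OF nm(2)] by (intro steep) simp_all
    also have "\<dots> = C * a ^ m * ((a - b) * (1 - ?w (Suc m))) / h"
      using F_increment_in_cylinder[OF e ev nm(1) k z y] unfolding Fz C_def by simp
    finally have "Z * h \<le> C * a ^ m * ((a - b) * (1 - ?w (Suc m)))"
      using h0 by (simp add: field_simps)
    moreover have "Z * (1 / B ^ Suc m) \<le> Z * h"
      using h1(1) K C b_less a_pos by (intro mult_left_mono) (simp_all add: Z_def)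
    ultimately have "Z * (1 / B ^ Suc m) \<le> C * a ^ m * ((a - b) * (1 - ?w (Suc m)))" by linarith
    then have "(a * B ^ Suc m / (C * (a - b))) * (Z * (1 / B ^ Suc m))
        \<le> (a * B ^ Suc m / (C * (a - b))) * (C * a ^ m * ((a - b) * (1 - ?w (Suc m))))"
      using C b_less a_pos B_pos(2)[of "Suc m"] by (intro mult_left_mono) simp_all
    moreover have "(a * B ^ Suc m / (C * (a - b))) * (Z * (1 / B ^ Suc m)) = K"
      using C b_less a_pos B_pos by (simp add: Z_def)
    moreover have "(a * B ^ Suc m / (C * (a - b))) * (C * a ^ m * ((a - b) * (1 - ?w (Suc m))))
        = ?g (Suc m)"
      using C b_less by (simp add: power_mult_distrib)
    ultimately show ?thesis by simp
  qed
  \<comment> \<open>With \<open>w\<close> for the tail sum, \<open>w n = a (N + w (n + 1))\<close> at a digit \<open>2 N\<close>, so that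
    \<open>a (1 - w (n + 1)) = (1 - w n) + (a (N + 1) - 1) \<ge> 1 - w n\<close>.\<close>
  have run: "K \<le> ?g (Suc n)" if n: "n0 < n" "\<xi> (Suc n) = 2 * N" "K \<le> ?g n" for n
  proof -
    have tail: "a * F (rem x \<xi> i) = (a - b) * ?w i" if "n0 \<le> i" for i
      using that ev by (intro F_remainder_tail_sum d r) simp
    have "F (rem x \<xi> n) = (a - b) * (real N + ?w (Suc n))"
      using n ev by (intro F_remainder_even_tail[OF e]) simp_all
    then have "(a - b) * ?w n = a * ((a - b) * (real N + ?w (Suc n)))"
      using tail[of n] n(1) by (simp only: less_imp_le)
    then have "(a - b) * ?w n = (a - b) * (a * (real N + ?w (Suc n)))"
      by (simp only: mult.left_commute)
    then have "?w n = a * (real N + ?w (Suc n))"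
      unfolding mult_cancel_left using b_less by auto
    then have "a * (1 - ?w (Suc n)) = (1 - ?w n) + (a * (real N + 1) - 1)"
      by (simp add: algebra_simps)
    moreover have "0 \<le> a * (real N + 1) - 1" using a_gt by (simp add: field_simps)
    ultimately have "1 - ?w n \<le> a * (1 - ?w (Suc n))" by linarith
    then have "B * ((B * a) ^ n * (1 - ?w n)) \<le> B * ((B * a) ^ n * (a * (1 - ?w (Suc n))))"
      using B_pos a_pos by (intro mult_left_mono) simp_all
    also have "\<dots> = ?g (Suc n)" by simp
    finally have "B * ?g n \<le> ?g (Suc n)" .
    moreover have "1 * K \<le> B * ?g n" using n(3) B_gt_1 K by (intro mult_mono) simp_all
    ultimately show ?thesis by simp
  qed
  obtain n2 where n2: "Suc (max n0 n1) \<le> n2" "\<xi> n2 \<noteq> 2 * N"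
    using nt unfolding INFM_nat_le by blast
  have "K \<le> ?g n" if "n2 \<le> n" for n
    using that
  proof (induction n rule: dec_induct)
    case base
    have "Suc (n2 - 1) = n2" "max n0 n1 \<le> n2 - 1" using n2(1) by linarith+
    then show ?case using direct[of "n2 - 1"] n2(2) by simp
  next
    case (step n)
    have "n0 < n" "n1 \<le> n" using step.hyps(1) n2(1) by linarith+
    with step.IH show ?case using direct[of n] run[of n] by (cases "\<xi> (Suc n) = 2 * N") auto
  qed
  then show "\<forall>\<^sub>F n in sequentially. K \<le> ?g n" unfolding eventually_sequentially by blast
qed


section \<open>Reflection and the two-sided derivative\<close>

definition reflect :: "(nat \<Rightarrow> nat) \<Rightarrow> nat \<Rightarrow> nat" where
  "reflect \<xi> i = 2 * N - \<xi> i"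

text \<open>The digits \<open>2 N\<close> alone expand \<open>1\<close>; subtract termwise.\<close>

lemma base_expansion_reflect:
  assumes e: "base_expansion N x \<xi>"
  shows "base_expansion N (1 - x) (reflect \<xi>)"
proof -
  have d: "\<xi> (Suc i) \<le> 2 * N" for i using e by (simp add: base_expansion_def)
  have "(\<lambda>i. real (2 * N) / B * (1 / B) ^ i) sums (real (2 * N) / B * (1 / (1 - 1 / B)))"
    using B_gt_1 by (intro sums_mult geometric_sums) simp
  moreover have "1 - 1 / B = real (2 * N) / B"
    by (simp add: B_def field_simps)
  then have "real (2 * N) / B * (1 / (1 - 1 / B)) = 1"
    using N B_gt_1 by simp
  ultimately have "(\<lambda>i. real (2 * N) / B * (1 / B) ^ i) sums 1"
    by (simp only:)
  then have "(\<lambda>i. real (2 * N) / B ^ Suc i) sums 1"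
    by (simp add: power_one_over)
  moreover have "(\<lambda>i. real (\<xi> (Suc i)) / B ^ Suc i) sums x"
    using e unfolding base_expansion_def B_def by blast
  ultimately have "(\<lambda>i. real (2 * N) / B ^ Suc i - real (\<xi> (Suc i)) / B ^ Suc i) sums (1 - x)"
    by (rule sums_diff)
  moreover have "real (2 * N) / B ^ Suc i - real (\<xi> (Suc i)) / B ^ Suc i
      = real (reflect \<xi> (Suc i)) / B ^ Suc i" for i
    using d[of i] by (simp add: reflect_def of_nat_diff diff_divide_distrib)
  ultimately show ?thesis
    unfolding base_expansion_def B_def by (simp add: reflect_def)
qed

lemma remainder_reflect:
  assumes "\<And>i. \<xi> (Suc i) \<le> 2 * N"
  shows "rem (1 - x) (reflect \<xi>) n = 1 - rem x \<xi> n"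
proof (induction n)
  case (Suc n)
  have "real (reflect \<xi> (Suc n)) = B - 1 - real (\<xi> (Suc n))"
    using assms[of n] by (simp add: reflect_def B_def of_nat_diff)
  then show ?case
    unfolding rem_Suc Suc.IH by (simp add: right_diff_distrib)
qed (simp add: remainder_0)

lemma cylinder_slope_reflect:
  assumes "\<And>i. \<xi> (Suc i) \<le> 2 * N"
  shows "cylinder_slope (reflect \<xi>) n = cylinder_slope \<xi> n"
proof -
  have "piece_slope (reflect \<xi> (Suc i)) = piece_slope (\<xi> (Suc i))" for i
    using assms[of i] by (simp add: piece_slope_def reflect_def)
  then show ?thesis by (simp add: cylinder_slope_def)
qed

lemma growth_condition_reflect:
  assumes "\<And>i. \<xi> (Suc i) \<le> 2 * N"
  shows "growth_condition N a (omega (reflect \<xi>)) \<longleftrightarrow> growth_condition N a (omega_bar N \<xi>)"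
proof -
  have "omega (reflect \<xi>) (n + Suc j) = omega_bar N \<xi> (n + Suc j)" for n j
    using assms[of "n + j"]
    by (simp add: omega_def omega_bar_def reflect_def of_nat_diff diff_divide_distrib)
  then show ?thesis by (simp add: growth_condition_def)
qed

text \<open>Since \<open>F (1 - y) = 1 - F y\<close>, the difference quotient of \<open>F\<close> at \<open>x\<close> for the step \<open>- h\<close> is the one at
  \<open>1 - x\<close> for the step \<open>h\<close>. As the symmetry holds on \<open>[0, 1]\<close>, this needs \<open>h < x\<close>.\<close>

lemma infinite_slope_reflect:
  assumes x: "0 < x" "x < 1"
  shows "infinite_slope \<sigma> x (at_left 0) \<longleftrightarrow> infinite_slope \<sigma> (1 - x) (at_right 0)"
proof -
  have "\<forall>\<^sub>F h in at_right 0. h < x"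
    unfolding eventually_at_right_field using x(1) by blast
  moreover have "\<forall>\<^sub>F h in at_right (0::real). 0 < h"
    by (simp add: eventually_at_right_less)
  ultimately have "\<forall>\<^sub>F h in at_right 0. \<sigma> * ((F (x + - h) - F x) / - h)
      = \<sigma> * ((F (1 - x + h) - F (1 - x)) / h)"
  proof eventually_elim
    case (elim h)
    have "1 - x + h = 1 - (x - h)" by simp
    then have "F (1 - x + h) = F (1 - (x - h))" by (simp only:)
    also have "\<dots> = 1 - F (x - h)" by (rule F_reflect) (use elim x in linarith)+
    finally have "F (1 - x + h) = 1 - F (x - h)" .
    moreover have "F (1 - x) = 1 - F x" using F_reflect[of x] x by simp
    ultimately have "F (1 - x + h) - F (1 - x) = F x - F (x - h)" by linarith
    then show ?case by (simp add: minus_divide_left)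
  qed
  then show ?thesis
    unfolding infinite_slope_def filterlim_at_left_to_right[where a = 0] minus_zero
    by (intro filterlim_cong refl)
qed

lemma infinite_slope_iff_growth:
  assumes x: "0 < x" "x < 1" and e: "base_expansion N x \<xi>"
    and ev: "\<And>i. n0 < i \<Longrightarrow> even (\<xi> i)"
    and nt: "\<exists>\<^sub>\<infinity>n. \<xi> n \<noteq> 2 * N" and nz: "\<exists>\<^sub>\<infinity>n. \<xi> n \<noteq> 0"
  shows "infinite_slope (sgn (cylinder_slope \<xi> n0)) x (at 0) \<longleftrightarrow>
    growth_condition N a (omega \<xi>) \<and> growth_condition N a (omega_bar N \<xi>)"
proof -
  have d: "\<xi> (Suc i) \<le> 2 * N" for i using e by (simp add: base_expansion_def)
  have right: "infinite_slope (sgn (cylinder_slope \<xi> n0)) x (at_right 0)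
      \<longleftrightarrow> growth_condition N a (omega \<xi>)"
    using right_slope_of_growth[where ?n0.0 = n0, OF e ev nt] growth_of_right_slope[where ?n0.0 = n0, OF e ev nt] by blast
  have e': "base_expansion N (1 - x) (reflect \<xi>)" by (rule base_expansion_reflect[OF e])
  have ev': "even (reflect \<xi> i)" if "n0 < i" for i
    using ev[OF that] by (simp add: reflect_def)
  have "\<exists>i\<ge>m. reflect \<xi> i \<noteq> 2 * N" for m
  proof -
    obtain i where "Suc m \<le> i" "\<xi> i \<noteq> 0" using nz unfolding INFM_nat_le by blast
    then show ?thesis using N by (intro exI[of _ i]) (auto simp: reflect_def)
  qed
  then have nt': "\<exists>\<^sub>\<infinity>i. reflect \<xi> i \<noteq> 2 * N" unfolding INFM_nat_le by blast
  have "infinite_slope (sgn (cylinder_slope \<xi> n0)) (1 - x) (at_right 0)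
      \<longleftrightarrow> growth_condition N a (omega_bar N \<xi>)"
    using right_slope_of_growth[where ?n0.0 = n0, OF e' ev' nt'] growth_of_right_slope[where ?n0.0 = n0, OF e' ev' nt']
    unfolding cylinder_slope_reflect[of \<xi>, OF d] growth_condition_reflect[of \<xi>, OF d] by blast
  then show ?thesis
    unfolding infinite_slope_two_sided infinite_slope_reflect[OF x] using right by blast
qed

section \<open>Expansions that end in zeros\<close>

text \<open>Along zero digits the remainder is multiplied by \<open>B\<close> at each step, yet stays at most \<open>1\<close>; so it
  vanishes.\<close>

lemma remainder_eq_0:
  assumes e: "base_expansion N x \<xi>" and z: "\<And>i. n < i \<Longrightarrow> \<xi> i = 0"
  shows "rem x \<xi> n = 0"
proof (rule ccontr)
  assume "rem x \<xi> n \<noteq> 0"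
  then have pos: "0 < rem x \<xi> n" using remainder_bounds(1)[OF N e, of n] by simp
  have grow: "rem x \<xi> (n + j) = B ^ j * rem x \<xi> n" for j
    by (induction j) (simp_all add: rem_Suc z)
  obtain j where "1 / rem x \<xi> n < B ^ j" using real_arch_pow[OF B_gt_1] by blast
  then have "1 < rem x \<xi> (n + j)" unfolding grow using pos by (simp add: field_simps)
  then show False using remainder_bounds(2)[OF N e, of "n + j"] by simp
qed

lemma greedy_not_eventually_top:
  assumes x: "0 \<le> x" "x < 1" and g: "base_digits N x \<xi>"
  shows "\<exists>\<^sub>\<infinity>n. \<xi> n \<noteq> 2 * N"
proof (rule ccontr)
  assume "\<not> ?thesis"
  then obtain m where m: "\<And>n. m \<le> n \<Longrightarrow> \<xi> n = 2 * N" unfolding INFM_nat_le by blast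
  have e: "base_expansion N x \<xi>" using g by (simp add: base_digits_def)
  have d: "\<xi> (Suc i) \<le> 2 * N" for i using e by (simp add: base_expansion_def)
  have "rem (1 - x) (reflect \<xi>) m = 0"
    using m by (intro remainder_eq_0[OF base_expansion_reflect[OF e]]) (simp add: reflect_def)
  then have "rem x \<xi> m = 1" using remainder_reflect[of \<xi>, OF d] by simp
  moreover have "rem x \<xi> m = rem x (floor_digit N x) m"
    using g unfolding base_digits_iff[OF N x] by (intro remainder_cong) simp
  ultimately show False
    using remainder_floor_digit[OF x, of N m] frac_lt_1[of "real (2 * N + 1) ^ m * x"] by simp
qed

text \<open>Such an \<open>x\<close> has the second expansion \<open>\<zeta>\<close> that lowers the last nonzero digit by \<open>1\<close> and continues
  with digits \<open>2 N\<close>. The two expansions belong to the cylinders on the two sides of \<open>x\<close>, whose scaling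
  factors have opposite signs because exactly one digit has changed its parity.\<close>

lemma no_infinite_slope_at_node:
  assumes x: "0 < x" and e: "base_expansion N x \<xi>" and z: "\<not> (\<exists>\<^sub>\<infinity>n. \<xi> n \<noteq> 0)"
  shows "\<not> infinite_slope \<sigma> x (at 0)"
proof
  assume inf: "infinite_slope \<sigma> x (at 0)"
  have d: "\<xi> (Suc i) \<le> 2 * N" for i using e by (simp add: base_expansion_def)
  note r = remainder_bounds[OF N e]
  define A where "A = {i. 0 < i \<and> \<xi> i \<noteq> 0}"
  obtain M where M: "\<And>n. M \<le> n \<Longrightarrow> \<xi> n = 0" using z unfolding INFM_nat_le by blast
  have "i < M" if "i \<in> A" for i
    using M[of i] that by (cases "M \<le> i") (simp_all add: A_def)
  then have "A \<subseteq> {..<M}" by blast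
  then have fin: "finite A" by (rule finite_subset) simp
  have "A \<noteq> {}"
  proof
    assume "A = {}"
    then have "\<xi> i = 0" if "0 < i" for i using that unfolding A_def by blast
    then have "rem x \<xi> 0 = 0" by (rule remainder_eq_0[OF e])
    then show False using x by (simp add: remainder_0)
  qed
  define p where "p = Max A"
  have "p \<in> A" unfolding p_def using fin \<open>A \<noteq> {}\<close> by (rule Max_in)
  then obtain q where q: "p = Suc q" and pq: "\<xi> (Suc q) \<noteq> 0"
    unfolding A_def by (auto simp: gr0_conv_Suc)
  have after: "\<xi> i = 0" if "p < i" for i
  proof (rule ccontr)
    assume "\<xi> i \<noteq> 0"
    then have "i \<in> A" using that by (simp add: A_def)
    then have "i \<le> p" unfolding p_def by (rule Max_ge[OF fin])
    then show False using that by simp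
  qed
  define \<zeta> where "\<zeta> i = (if i < p then \<xi> i else if i = p then \<xi> p - 1 else 2 * N)" for i
  have d': "\<zeta> (Suc i) \<le> 2 * N" for i
    using d[of i] unfolding \<zeta>_def by auto
  have same: "rem x \<zeta> n = rem x \<xi> n" if "n \<le> q" for n
    using that by (intro remainder_cong) (simp add: \<zeta>_def q)
  have one: "rem x \<zeta> n = 1" if "p \<le> n" for n
    using that
  proof (induction n rule: dec_induct)
    case base
    have "rem x \<xi> p = 0" using after by (rule remainder_eq_0[OF e])
    then show ?case
      using same[of q] pq unfolding q rem_Suc by (simp add: \<zeta>_def q of_nat_diff)
  next
    case (step n)
    then have "\<zeta> (Suc n) = 2 * N" by (simp add: \<zeta>_def)
    then show ?case unfolding rem_Suc step.IH by (simp add: B_def)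
  qed
  have r': "0 \<le> rem x \<zeta> n" "rem x \<zeta> n \<le> 1" for n
    using same[of n] one[of n] r[of n] q by (cases "n \<le> q"; simp)+
  have "\<forall>\<^sub>F n in sequentially. p \<le> n \<and> 0 < \<sigma> * cylinder_slope \<xi> n \<and> 0 < \<sigma> * cylinder_slope \<zeta> n"
    by (intro eventually_conj eventually_ge_at_top infinite_slope_sign[OF _ _ _ inf] d d' r r')
  then obtain n where n: "p \<le> n" "0 < \<sigma> * cylinder_slope \<xi> n" "0 < \<sigma> * cylinder_slope \<zeta> n"
    using eventually_happens[of _ sequentially] by auto
  have "cylinder_slope \<zeta> q = cylinder_slope \<xi> q"
    unfolding cylinder_slope_def by (intro prod.cong refl) (simp add: \<zeta>_def q)
  then have "cylinder_slope \<xi> n = cylinder_slope \<xi> q * piece_slope (\<xi> p) * a ^ (n - p)"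
    "cylinder_slope \<zeta> n = cylinder_slope \<xi> q * piece_slope (\<zeta> p) * a ^ (n - p)"
    using cylinder_slope_even_tail[of p \<xi> n] cylinder_slope_even_tail[of p \<zeta> n] after n(1)
    unfolding q cylinder_slope_Suc by (simp_all add: \<zeta>_def q)
  then have "(\<sigma> * cylinder_slope \<xi> n) * (\<sigma> * cylinder_slope \<zeta> n)
      = (\<sigma> * cylinder_slope \<xi> q * a ^ (n - p))\<^sup>2 * (piece_slope (\<xi> p) * piece_slope (\<zeta> p))"
    by (simp add: power2_eq_square)
  also have "\<dots> \<le> 0"
  proof (rule mult_nonneg_nonpos)
    have "\<zeta> p = \<xi> p - 1" "\<xi> p \<noteq> 0" using pq by (simp_all add: \<zeta>_def q)
    then show "piece_slope (\<xi> p) * piece_slope (\<zeta> p) \<le> 0"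
      using a_pos b_pos by (simp add: piece_slope_def)
  qed simp
  finally show False using mult_pos_pos[OF n(2,3)] by simp
qed

text \<open>Once all digits are zero, the series is geometric with sum \<open>N a / (1 - a)\<close>, which is at least \<open>1\<close>
  because \<open>a (N + 1) > 1\<close>.\<close>

lemma no_growth_bar_at_node:
  assumes z: "\<not> (\<exists>\<^sub>\<infinity>n. \<xi> n \<noteq> 0)"
  shows "\<not> growth_condition N a (omega_bar N \<xi>)"
proof
  assume g: "growth_condition N a (omega_bar N \<xi>)"
  obtain M where M: "\<And>n. M \<le> n \<Longrightarrow> \<xi> n = 0" using z unfolding INFM_nat_le by blast
  have "\<forall>\<^sub>F n in sequentially. 0 < (B * a) ^ n * (1 - tail_sum (omega_bar N \<xi>) n)"
    using g unfolding growth_condition_tail_sum filterlim_at_top_dense by blast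
  then have "\<forall>\<^sub>F n in sequentially. M \<le> n \<and> 0 < (B * a) ^ n * (1 - tail_sum (omega_bar N \<xi>) n)"
    by (intro eventually_conj eventually_ge_at_top)
  then obtain n where n: "M \<le> n" "0 < (B * a) ^ n * (1 - tail_sum (omega_bar N \<xi>) n)"
    using eventually_happens[of _ sequentially] by auto
  have "(\<lambda>j. a * real N * a ^ j) sums (a * real N * (1 / (1 - a)))"
    using a_pos a_lt by (intro sums_mult geometric_sums) simp
  moreover have "a ^ Suc j * omega_bar N \<xi> (n + Suc j) = a * real N * a ^ j" for j
    using M[of "n + Suc j"] n(1) by (simp add: omega_bar_def omega_def)
  ultimately have "tail_sum (omega_bar N \<xi>) n = a * real N * (1 / (1 - a))"
    unfolding tail_sum_def by (simp only: sums_unique[symmetric])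
  moreover have "1 \<le> a * real N * (1 / (1 - a))"
    using a_gt a_lt by (simp add: field_simps)
  ultimately have "1 - tail_sum (omega_bar N \<xi>) n \<le> 0" by simp
  moreover have "0 \<le> (B * a) ^ n" using B_pos a_pos by simp
  ultimately show False using n(2) mult_nonneg_nonpos[of "(B * a) ^ n"] by fastforce
qed

section \<open>Characterisation of infinite derivatives\<close>

text \<open>Each odd digit changes the sign of the cylinder slope, which is eventually constant.\<close>

lemma infinite_slope_finite_odd:
  assumes e: "base_expansion N x \<xi>" and inf: "infinite_slope \<sigma> x (at 0)"
  shows "finite {i. 1 \<le> i \<and> odd (\<xi> i)}"
proof -
  have d: "\<xi> (Suc i) \<le> 2 * N" for i using e by (simp add: base_expansion_def)
  obtain m where m: "\<And>n. m \<le> n \<Longrightarrow> 0 < \<sigma> * cylinder_slope \<xi> n"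
    using infinite_slope_sign[OF d remainder_bounds[OF N e] inf]
    unfolding eventually_sequentially by blast
  have "even (\<xi> (Suc n))" if "m \<le> n" for n
  proof (rule ccontr)
    assume "odd (\<xi> (Suc n))"
    then have "\<sigma> * cylinder_slope \<xi> (Suc n) = - b * (\<sigma> * cylinder_slope \<xi> n)"
      by (simp add: cylinder_slope_Suc piece_slope_def)
    moreover have "0 < b * (\<sigma> * cylinder_slope \<xi> n)" using m[OF that] b_pos by simp
    ultimately show False using m[of "Suc n"] that by simp
  qed
  then have "i \<le> m" if "1 \<le> i" "odd (\<xi> i)" for i
  proof -
    obtain n where "i = Suc n" using \<open>1 \<le> i\<close> by (cases i) auto
    then show ?thesis using \<open>odd (\<xi> i)\<close> \<open>\<And>n. m \<le> n \<Longrightarrow> even (\<xi> (Suc n))\<close>[of n]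
      by (cases "m \<le> n") simp_all
  qed
  then have "{i. 1 \<le> i \<and> odd (\<xi> i)} \<subseteq> {..m}" by auto
  then show ?thesis by (rule finite_subset) simp
qed

lemma sgn_cylinder_slope:
  "sgn (cylinder_slope \<xi> n) = (- 1) ^ card {i \<in> {1..n}. odd (\<xi> i)}"
proof (induction n)
  case 0
  show ?case by (simp add: cylinder_slope_def)
next
  case (Suc n)
  define S where "S = {i \<in> {1..n}. odd (\<xi> i)}"
  have S: "finite S" "Suc n \<notin> S" by (simp_all add: S_def)
  have "{i \<in> {1..Suc n}. odd (\<xi> i)} = (if odd (\<xi> (Suc n)) then insert (Suc n) S else S)"
    by (auto simp: S_def le_Suc_eq)
  then have card: "card {i \<in> {1..Suc n}. odd (\<xi> i)}
      = (if odd (\<xi> (Suc n)) then Suc (card S) else card S)"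
    using S by simp
  show ?case
    unfolding card cylinder_slope_Suc sgn_mult Suc.IH S_def[symmetric]
    using a_pos b_pos by (simp add: piece_slope_def)
qed

lemma infinite_derivative_iff:
  assumes x: "0 < x" "x < 1" and g: "base_digits N x \<xi>" and \<sigma>: "\<sigma> = 1 \<or> \<sigma> = - 1"
  shows "infinite_slope \<sigma> x (at 0) \<longleftrightarrow>
    finite {i. 1 \<le> i \<and> odd (\<xi> i)} \<and> \<sigma> = (- 1) ^ card {i. 1 \<le> i \<and> odd (\<xi> i)} \<and>
    growth_condition N a (omega \<xi>) \<and> growth_condition N a (omega_bar N \<xi>)"
proof -
  let ?O = "{i. 1 \<le> i \<and> odd (\<xi> i)}"
  have e: "base_expansion N x \<xi>" using g by (simp add: base_digits_def)
  have d: "\<xi> (Suc i) \<le> 2 * N" for i using e by (simp add: base_expansion_def)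
  have nt: "\<exists>\<^sub>\<infinity>n. \<xi> n \<noteq> 2 * N"
    using x by (intro greedy_not_eventually_top[OF _ _ g]) simp_all
  consider "infinite ?O" | "\<not> (\<exists>\<^sub>\<infinity>n. \<xi> n \<noteq> 0)" | "finite ?O" "\<exists>\<^sub>\<infinity>n. \<xi> n \<noteq> 0" by blast
  then show ?thesis
  proof cases
    case 1
    then show ?thesis using infinite_slope_finite_odd[OF e] by blast
  next
    case 2
    then show ?thesis using no_infinite_slope_at_node[OF x(1) e] no_growth_bar_at_node by blast
  next
    case 3
    obtain n0 where n0: "\<And>i. i \<in> ?O \<Longrightarrow> i \<le> n0"
      using 3(1) unfolding finite_nat_set_iff_bounded_le by blast
    have ev: "even (\<xi> i)" if "n0 < i" for i
      using n0[of i] that by force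
    have sgn: "sgn (cylinder_slope \<xi> n) = (- 1) ^ card ?O" if "n0 \<le> n" for n
    proof -
      have "i \<le> n" if "i \<in> ?O" for i using n0[OF that] \<open>n0 \<le> n\<close> by simp
      then have "{i \<in> {1..n}. odd (\<xi> i)} = ?O" by auto
      then show ?thesis using sgn_cylinder_slope[of \<xi> n] by (simp only:)
    qed
    have sign: "\<sigma> = (- 1) ^ card ?O" if inf: "infinite_slope \<sigma> x (at 0)"
    proof -
      have "\<forall>\<^sub>F n in sequentially. n0 \<le> n \<and> 0 < \<sigma> * cylinder_slope \<xi> n"
        by (intro eventually_conj eventually_ge_at_top infinite_slope_sign[OF _ _ _ inf]
            d remainder_bounds[OF N e])
      then obtain n where n: "n0 \<le> n" "0 < \<sigma> * cylinder_slope \<xi> n"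
        using eventually_happens[of _ sequentially] by auto
      then have "\<sigma> = sgn (cylinder_slope \<xi> n)" using \<sigma> by auto
      then show ?thesis using sgn[OF n(1)] by simp
    qed
    have iff: "infinite_slope ((- 1) ^ card ?O) x (at 0) \<longleftrightarrow>
        growth_condition N a (omega \<xi>) \<and> growth_condition N a (omega_bar N \<xi>)"
      using infinite_slope_iff_growth[where ?n0.0 = n0, OF x e ev nt 3(2)]
      unfolding sgn[OF order_refl] .
    show ?thesis
    proof (cases "\<sigma> = (- 1) ^ card ?O")
      case True
      show ?thesis using iff[folded True] True 3(1) by blast
    next
      case False
      then show ?thesis using sign by blast
    qed
  qed
qed

end

theorem theorem2p3:
  fixes N :: nat and a x :: real and \<xi> :: "nat \<Rightarrow> nat"
  assumes "0 < N" and "1 / (real N + 1) < a" and "a < 1"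
    and "0 < x" and "x < 1"
    and "base_digits N x \<xi>"
  shows "((has_deriv_pinfty (F_fun N a) x \<or> has_deriv_minfty (F_fun N a) x) \<longleftrightarrow>
            odd_count \<xi> < \<infinity> \<and>
            growth_condition N a (omega \<xi>) \<and>
            growth_condition N a (omega_bar N \<xi>)) \<and>
         (odd_count \<xi> < \<infinity> \<and>
            growth_condition N a (omega \<xi>) \<and>
            growth_condition N a (omega_bar N \<xi>) \<longrightarrow>
            (even (the_enat (odd_count \<xi>)) \<longrightarrow> has_deriv_pinfty (F_fun N a) x) \<and>
            (odd (the_enat (odd_count \<xi>)) \<longrightarrow> has_deriv_minfty (F_fun N a) x))"
proof -
  interpret self_affine N a using assms by unfold_locales
  define odds where "odds = {i. 1 \<le> i \<and> odd (\<xi> i)}"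
  have sign: "(1::real) = (- 1) ^ card odds \<longleftrightarrow> even (card odds)"
    "(- 1::real) = (- 1) ^ card odds \<longleftrightarrow> odd (card odds)"
    by (simp_all add: minus_one_power_iff)
  have pos: "has_deriv_pinfty (F_fun N a) x \<longleftrightarrow> finite odds \<and> even (card odds) \<and>
      growth_condition N a (omega \<xi>) \<and> growth_condition N a (omega_bar N \<xi>)"
    using infinite_derivative_iff[OF assms(4-6), of 1]
    unfolding has_deriv_pinfty_iff odds_def[symmetric] sign by blast
  have neg: "has_deriv_minfty (F_fun N a) x \<longleftrightarrow> finite odds \<and> odd (card odds) \<and>
      growth_condition N a (omega \<xi>) \<and> growth_condition N a (omega_bar N \<xi>)"
    using infinite_derivative_iff[OF assms(4-6), of "- 1"]
    unfolding has_deriv_minfty_iff odds_def[symmetric] sign by blast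
  have fin: "odd_count \<xi> < \<infinity> \<longleftrightarrow> finite odds"
    by (simp add: odd_count_def odds_def)
  have card: "the_enat (odd_count \<xi>) = card odds" if "finite odds"
    using that by (simp add: odd_count_def odds_def)
  show ?thesis
  proof (cases "finite odds")
    case True
    show ?thesis unfolding pos neg fin card[OF True] by blast
  next
    case False
    then show ?thesis unfolding pos neg fin by blast
  qed
qed

end
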